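(* Let $n\ge 0$ be an integer, and let $f^\pm(x,y)=\sum_{i+j=0}^n a^\pm_{i,j}x^iy^j$ and $g^\pm(x,y)=\sum_{i+j=0}^n b^\pm_{i,j}x^iy^j$ be real polynomials of degree at most $n$ such that $a^+_{i,j}=a^-_{i,j}$ and $b^+_{i,j}=b^-_{i,j}$ for all $i,j$. For each of the four cases $S_1$, $S_2$, $(r19)$, $(r20)$ (with the corresponding $k$, $H$, $\Sigma$, $\Gamma_h^\pm$ given in the context), consider the Abelian integral $$M(h)=\int_{\Gamma^+_h}x^{-k-1}\big[g^+(x,y)\,dx-f^+(x,y)\,dy\big]+\int_{\Gamma^-_h}x^{-k-1}\big[g^-(x,y)\,dx-f^-(x,y)\,dy\big],\qquad h\in\Sigma .$$ Then the number of isolated zeros of $M$ in $\Sigma$, counted with multiplicity, satisfies the following. (i) For $S_1$ it is at most $2n$ for every $n\ge 0$. For $S_2$ it is at most $2n-1$ if $n\ge 1$, and at most $1$ if $n=0$. (ii) For $(r19)$ it is at most $2n-3$ if $n\ge 4$, and at most $4$ if $n\in\{0,1,2,3\}$. For $(r20)$ it is at most $2n$ if $n\ge 3$, and at most $3$ if $n\in\{0,1,2\}$.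
   Context: In each case set $H(x,y)=x^{-k}\big(\tfrac12y^2+\lambda_2x^2+\lambda_1x+\lambda_0\big)$, a first integral of the stated planar system, with the following data. $S_1$: system $\dot x=\sqrt2\,xy,\ \dot y=\tfrac{\sqrt2}{4}(1-x^2+2y^2)$; $k=1$, $\lambda_2=\tfrac14$, $\lambda_1=-\tfrac12$, $\lambda_0=\tfrac14$; $\Sigma=(-\infty,-1)\cup(0,+\infty)$ (the level curves with $h>0$ are closed orbits around the center $(1,0)$ in $x>0$, those with $h<-1$ are closed orbits around the center $(-1,0)$ in $x<0$). $S_2$: system $\dot x=\tfrac{\sqrt2}{2}xy,\ \dot y=\tfrac{\sqrt2}{2}(2-2x+y^2)$; $k=2$, $\lambda_2=1$, $\lambda_1=-2$, $\lambda_0=1$; $\Sigma=(0,1)$ (closed orbits around $(1,0)$ in $x>0$). $(r19)$: system $\dot x=-xy,\ \dot y=-\tfrac34y^2+\tfrac1{2^8}x^2-\tfrac1{2^8}x$; $k=\tfrac32$, $\lambda_2=\lambda_1=\tfrac1{2^7}$, $\lambda_0=0$; $\Sigma=(\tfrac1{2^6},+\infty)$ (closed orbits around $(1,0)$ in $x>0$). $(r20)$: system $\dot x=-xy,\ \dot y=-\tfrac14y^2+\tfrac1{2^8}x-\tfrac1{2^8}$; $k=\tfrac12$, $\lambda_2=0$, $\lambda_1=\lambda_0=\tfrac1{2^7}$; $\Sigma=(\tfrac1{2^6},+\infty)$ (closed orbits around $(1,0)$ in $x>0$). For $h\in\Sigma$, $\Gamma_h^+=\{(x,y): H(x,y)=h,\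 y>0\}$ and $\Gamma_h^-=\{(x,y): H(x,y)=h,\ y<0\}$ are the upper and lower arcs of the closed orbit $\{H=h\}$, both oriented by the flow of the stated system. The sums $\sum_{i+j=0}^n$ run over integers $i,j\ge0$ with $i+j\le n$. *)

theory Defs
  imports "HOL-Analysis.Analysis" "HOL-Library.Extended_Nat"
begin

datatype system = S1 | S2 | R19 | R20

text \<open>
  The real power \<open>x\<^sup>r\<close>, also for negative \<open>x\<close> when the exponent is an integer.
  For negative \<open>x\<close>, \<open>powr\<close> would not give the correct sign, which matters for \<open>S1\<close>.
\<close>

definition rpow :: "real \<Rightarrow> real \<Rightarrow> real" where
  "rpow x r = (if r \<in> \<int> then x powi \<lfloor>r\<rfloor> else x powr r)"

primrec vfield :: "system \<Rightarrow> real \<times> real \<Rightarrow> real \<times> real" where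
  "vfield S1 = (\<lambda>(x, y). (sqrt 2 * x * y, sqrt 2 / 4 * (1 - x^2 + 2 * y^2)))"
| "vfield S2 = (\<lambda>(x, y). (sqrt 2 / 2 * x * y, sqrt 2 / 2 * (2 - 2 * x + y^2)))"
| "vfield R19 = (\<lambda>(x, y). (- x * y, - (3/4) * y^2 + 1 / 2^8 * x^2 - 1 / 2^8 * x))"
| "vfield R20 = (\<lambda>(x, y). (- x * y, - (1/4) * y^2 + 1 / 2^8 * x - 1 / 2^8))"

primrec kexp :: "system \<Rightarrow> real" where
  "kexp S1 = 1" | "kexp S2 = 2" | "kexp R19 = 3/2" | "kexp R20 = 1/2"

primrec lam2 :: "system \<Rightarrow> real" where
  "lam2 S1 = 1/4" | "lam2 S2 = 1" | "lam2 R19 = 1 / 2^7" | "lam2 R20 = 0"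

primrec lam1 :: "system \<Rightarrow> real" where
  "lam1 S1 = - (1/2)" | "lam1 S2 = - 2" | "lam1 R19 = 1 / 2^7" | "lam1 R20 = 1 / 2^7"

primrec lam0 :: "system \<Rightarrow> real" where
  "lam0 S1 = 1/4" | "lam0 S2 = 1" | "lam0 R19 = 0" | "lam0 R20 = 1 / 2^7"

definition Hfun :: "system \<Rightarrow> real \<Rightarrow> real \<Rightarrow> real" where
  "Hfun s x y = rpow x (- kexp s) * (1/2 * y^2 + lam2 s * x^2 + lam1 s * x + lam0 s)"

text \<open>The natural domain of \<open>x\<^sup>-\<^sup>k\<close>.\<close>

definition xdom :: "system \<Rightarrow> real set" where
  "xdom s = (if kexp s \<in> \<int> then {x. x \<noteq> 0} else {x. x > 0})"

primrec Sig :: "system \<Rightarrow> real set" where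
  "Sig S1 = {..<-1} \<union> {0<..}"
| "Sig S2 = {0<..<1}"
| "Sig R19 = {1 / 2^6<..}"
| "Sig R20 = {1 / 2^6<..}"

definition upper_arc :: "system \<Rightarrow> real \<Rightarrow> (real \<times> real) set" where
  "upper_arc s h = {(x, y). x \<in> xdom s \<and> Hfun s x y = h \<and> y > 0}"

definition lower_arc :: "system \<Rightarrow> real \<Rightarrow> (real \<times> real) set" where
  "lower_arc s h = {(x, y). x \<in> xdom s \<and> Hfun s x y = h \<and> y < 0}"

text \<open>
  \<open>g\<close> parametrizes the relatively open arc \<open>\<Gamma>\<close> in the direction of the vector field \<open>V\<close>.
  The parameters \<open>0\<close> and \<open>1\<close> correspond to the two end points of \<open>\<Gamma>\<close>, which are not in \<open>\<Gamma>\<close>;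
  the parameter need not be the time of the flow.
\<close>

definition flow_parametrization ::
  "(real \<times> real \<Rightarrow> real \<times> real) \<Rightarrow> (real \<times> real) set \<Rightarrow> (real \<Rightarrow> real \<times> real) \<Rightarrow> bool" where
  "flow_parametrization V \<Gamma> g \<longleftrightarrow>
     arc g \<and> g ` {0<..<1} = \<Gamma> \<and> g C1_differentiable_on {0<..<1} \<and>
     (\<forall>t\<in>{0<..<1}. \<exists>c>0. vector_derivative g (at t) = c *\<^sub>R V (g t))"

definition has_line_integral ::
  "(real \<Rightarrow> real \<Rightarrow> real) \<Rightarrow> (real \<Rightarrow> real \<Rightarrow> real) \<Rightarrow> real \<Rightarrow> (real \<Rightarrow> real \<times> real) \<Rightarrow> bool" where
  "has_line_integral P Q I g \<longleftrightarrow>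
     ((\<lambda>t. P (fst (g t)) (snd (g t)) * fst (vector_derivative g (at t))
         + Q (fst (g t)) (snd (g t)) * snd (vector_derivative g (at t))) has_integral I) {0..1}"

text \<open>
  The integral of \<open>P dx + Q dy\<close> over \<open>\<Gamma>\<close> oriented by \<open>V\<close>; its value does not depend on the
  parametrization.
\<close>

definition flow_integral ::
  "(real \<times> real \<Rightarrow> real \<times> real) \<Rightarrow> (real \<times> real) set \<Rightarrow>
   (real \<Rightarrow> real \<Rightarrow> real) \<Rightarrow> (real \<Rightarrow> real \<Rightarrow> real) \<Rightarrow> real" where
  "flow_integral V \<Gamma> P Q = (THE I. \<exists>g. flow_parametrization V \<Gamma> g \<and> has_line_integral P Q I g)"

definition poly2 :: "nat \<Rightarrow> (nat \<Rightarrow> nat \<Rightarrow> real) \<Rightarrow> real \<Rightarrow> real \<Rightarrow> real" where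
  "poly2 n a x y = (\<Sum>(i, j)\<in>{(i, j). i + j \<le> n}. a i j * x ^ i * y ^ j)"

definition abelian_integral ::
  "system \<Rightarrow> (real \<Rightarrow> real \<Rightarrow> real) \<Rightarrow> (real \<Rightarrow> real \<Rightarrow> real) \<Rightarrow>
   (real \<Rightarrow> real \<Rightarrow> real) \<Rightarrow> (real \<Rightarrow> real \<Rightarrow> real) \<Rightarrow> real \<Rightarrow> real" where
  "abelian_integral s fp gp fm gm h =
     flow_integral (vfield s) (upper_arc s h)
       (\<lambda>x y. rpow x (- kexp s - 1) * gp x y) (\<lambda>x y. - (rpow x (- kexp s - 1) * fp x y))
   + flow_integral (vfield s) (lower_arc s h)
       (\<lambda>x y. rpow x (- kexp s - 1) * gm x y) (\<lambda>x y. - (rpow x (- kexp s - 1) * fm x y))"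

definition isolated_zeros :: "(real \<Rightarrow> real) \<Rightarrow> real set \<Rightarrow> real set" where
  "isolated_zeros F S = {h \<in> S. F h = 0 \<and> (\<forall>\<^sub>F t in at h within S. F t \<noteq> 0)}"

text \<open>The order of the first non-vanishing derivative, \<open>\<infinity>\<close> if there is none.\<close>

definition zero_multiplicity :: "(real \<Rightarrow> real) \<Rightarrow> real \<Rightarrow> enat" where
  "zero_multiplicity F h = (INF m \<in> {m. (deriv ^^ m) F h \<noteq> 0}. enat m)"

definition num_isolated_zeros :: "(real \<Rightarrow> real) \<Rightarrow> real set \<Rightarrow> enat" where
  "num_isolated_zeros F S =
     (if finite (isolated_zeros F S) then \<Sum>h\<in>isolated_zeros F S. zero_multiplicity F h else \<infinity>)"

end

(*
  With S1 written as x = u or x = -1/u, S2 as x = u/w with w = sqrt (1 - h), and (r19), (r20) as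
  x = u^2, every oval becomes the conic v^2 = 2cu - u^2 - 1. Integrating the dy part by parts and
  using the symmetry y -> -y, M is a combination of integrals of u^l v^j du over the conic with j odd.
  Such an integral is eta * p(eta) with eta = (c - 1)/2 and deg p <= max (l + j) (-l - 2). Since c is affine in h (for S2, c = 1/w), M is a polynomial in h, respectively a Laurent
  polynomial in w vanishing at w = 1, and counting roots gives the bounds.
*)

theory Submission
  imports Defs "HOL-Computational_Algebra.Polynomial"
begin

section \<open>Multiplicities of zeros of functions of the form \<open>p(\<psi>) \<psi>\<^sup>N\<close>\<close>

text \<open>Multiplicity refers to iterated derivatives in h, whereas roots are counted in \<psi> =
  (c - 1)/2 or \<psi> = w. The transfer rests on a relation \<psi>' = \<kappa> \<psi>^e, with e = 0
  when \<psi> is affine and e = -1 for w, and on \<psi> > 0. The factor eta is positive on \<Sigma>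
  and adds no zeros. The inversion u -> 1/u preserves the conic, with v going to v/u, and exchanges
  l + j and -l - 2; therefore both ends of the exponent range enter the degree. One of the two
  numbers is bounded independently of n and dominates for small n. The degree count alone would be
  too weak for \<open>S1\<close> with n = 0 and for \<open>S2\<close> with n <= 1; there the oval
  integrals that occur on one component coincide, so M is a constant multiple of a function without
  zeros and has no isolated zero. The other counts are n on each component for \<open>S1\<close>, 2
  n - 2 for \<open>S2\<close>, max (2 n - 4) 3 for (r19) and max (2 n - 3) 2 for (r20).\<close>

lemma iterated_deriv_eq_on_open:
  fixes F G :: "real \<Rightarrow> real"
  assumes "open S" "\<And>h. h \<in> S \<Longrightarrow> F h = G h" "h \<in> S"
  shows "(deriv ^^ m) F h = (deriv ^^ m) G h"
  using assms(3)
proof (induction m arbitrary: h)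
  case (Suc m)
  have "eventually (\<lambda>x. (deriv ^^ m) F x = (deriv ^^ m) G x) (nhds h)"
    using eventually_nhds_in_open[OF assms(1) Suc.prems] by eventually_elim (rule Suc.IH)
  thus ?case by (auto intro: deriv_cong_ev)
qed (use assms in auto)

text \<open>
  The functions \<open>p(\<psi>) \<psi>\<^sup>N\<close> are closed under differentiation if \<open>\<psi>' = \<kappa> \<psi>\<^sup>e\<close>, and each derivative
  lowers the order of vanishing of the polynomial factor by at most one.
\<close>

lemma zero_multiplicity_poly_comp:
  fixes \<psi> F :: "real \<Rightarrow> real" and p :: "real poly" and N e :: int
  assumes S: "open S" and h: "h \<in> S" and \<kappa>: "\<kappa> \<noteq> 0"
    and \<psi>_pos: "\<And>h. h \<in> S \<Longrightarrow> \<psi> h > 0"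
    and \<psi>_deriv: "\<And>h. h \<in> S \<Longrightarrow> (\<psi> has_real_derivative \<kappa> * \<psi> h powi e) (at h)"
    and F: "\<And>h. h \<in> S \<Longrightarrow> F h = poly p (\<psi> h) * \<psi> h powi N"
    and p: "p \<noteq> 0"
  shows "zero_multiplicity F h \<le> enat (order (\<psi> h) p)"
proof -
  \<comment> \<open>The claim is general in G, q and M because the induction on r passes from G to
    its derivative, which replaces q by another polynomial and shifts the exponent M.\<close>
  have vanish: "[:- \<psi> h, 1:] ^ Suc r dvd q"
    if "\<And>m. m \<le> r \<Longrightarrow> (deriv ^^ m) G h = 0" "\<And>h. h \<in> S \<Longrightarrow> G h = poly q (\<psi> h) * \<psi> h powi M"
    for r q M and G :: "real \<Rightarrow> real"
    using that
  proof (induction r arbitrary: G q M)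
    case 0
    from "0.prems"(1)[of 0] "0.prems"(2)[OF h] \<psi>_pos[OF h] show ?case
      by (simp add: poly_eq_0_iff_dvd)
  next
    case (Suc r)
    have IH1: "[:- \<psi> h, 1:] ^ Suc r dvd q"
      by (rule Suc.IH[of G q M]) (use Suc.prems in auto)
    \<comment> \<open>The derivative of q(\<psi>) \<psi>^M is \<kappa> (\<psi>
      (\<open>pderiv q\<close>)(\<psi>) + M q(\<psi>)) \<psi>^(M - 1 + e), which is again of the
      same form.\<close>
    define q' where "q' = smult \<kappa> ([:0, 1:] * pderiv q + smult (of_int M) q)"
    have G': "deriv G x = poly q' (\<psi> x) * \<psi> x powi (M - 1 + e)" if x: "x \<in> S" for x
    proof -
      have ps: "\<psi> x > 0" by (rule \<psi>_pos[OF x])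
      have "((\<lambda>x. poly q (\<psi> x) * \<psi> x powi M) has_real_derivative
          poly (pderiv q) (\<psi> x) * (\<kappa> * \<psi> x powi e) * \<psi> x powi M
          + poly q (\<psi> x) * (of_int M * \<psi> x powi (M - 1) * (\<kappa> * \<psi> x powi e))) (at x)"
        using ps by (auto intro!: derivative_eq_intros DERIV_chain2[OF poly_DERIV] \<psi>_deriv[OF x])
      also have "poly (pderiv q) (\<psi> x) * (\<kappa> * \<psi> x powi e) * \<psi> x powi M
          + poly q (\<psi> x) * (of_int M * \<psi> x powi (M - 1) * (\<kappa> * \<psi> x powi e))
          = poly q' (\<psi> x) * \<psi> x powi (M - 1 + e)"
        using ps by (simp add: q'_def power_int_add power_int_diff field_simps)
      finally have "deriv (\<lambda>x. poly q (\<psi> x) * \<psi> x powi M) x = poly q' (\<psi> x) * \<psi> x powi (M - 1 + e)"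
        by (rule DERIV_imp_deriv)
      moreover have "deriv G x = deriv (\<lambda>x. poly q (\<psi> x) * \<psi> x powi M) x"
        using iterated_deriv_eq_on_open[OF S Suc.prems(2) x, where m = 1] by simp
      ultimately show ?thesis by simp
    qed
    have "[:- \<psi> h, 1:] ^ Suc r dvd q'"
    proof (rule Suc.IH[OF _ G'])
      fix m assume "m \<le> r"
      thus "(deriv ^^ m) (deriv G) h = 0"
        using Suc.prems(1)[of "Suc m"] by (simp add: funpow_swap1)
    qed auto
    \<comment> \<open>The divisibility already known for q removes the summand M q. The factor X is
      coprime to the linear factor because \<psi> h > 0, so \<open>pderiv q\<close> inherits the
      divisibility, and going back from \<open>pderiv q\<close> to q raises the order at the root
      \<psi> h by one.\<close>
    hence "[:- \<psi> h, 1:] ^ Suc r dvd smult \<kappa> ([:0, 1:] * pderiv q) + smult \<kappa> (smult (of_int M) q)"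
      by (simp only: q'_def smult_add_right)
    moreover have "[:- \<psi> h, 1:] ^ Suc r dvd smult \<kappa> (smult (of_int M) q)"
      by (intro dvd_smult IH1)
    ultimately have "[:- \<psi> h, 1:] ^ Suc r dvd smult \<kappa> ([:0, 1:] * pderiv q)"
      by (simp only: dvd_add_left_iff)
    hence d: "[:- \<psi> h, 1:] ^ Suc r dvd [:0, 1:] * pderiv q"
      using \<kappa> by (metis dvd_smult_cancel)
    show ?case
    proof (cases "q = 0")
      case False
      have q0: "order (\<psi> h) q \<noteq> 0" using IH1 False
        by (metis order_divides Suc_leD Suc_n_not_le_n le_0_eq not_less_eq_eq zero_le)
      have pd: "pderiv q \<noteq> 0"
      proof
        assume "pderiv q = 0"
        then obtain c where "q = [:c:]" using pderiv_iszero by blast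
        thus False using q0 False order_root[of q "\<psi> h"] by auto
      qed
      have "Suc r \<le> order (\<psi> h) ([:0, 1:] * pderiv q)"
        using d pd by (subst (asm) order_divides) auto
      also have "\<dots> = order (\<psi> h) [:0, 1:] + order (\<psi> h) (pderiv q)"
        using pd by (intro order_mult) auto
      also have "order (\<psi> h) [:0, 1:] = 0"
        using \<psi>_pos[OF h] by (intro order_0I) simp
      finally have "Suc (Suc r) \<le> order (\<psi> h) q"
        using order_pderiv[OF False] q0 order_root[of q "\<psi> h"] by simp
      thus ?thesis by (subst order_divides) simp
    qed simp
  qed
  have "\<exists>m \<le> order (\<psi> h) p. (deriv ^^ m) F h \<noteq> 0"
  proof (rule ccontr)
    assume "\<not> ?thesis"
    hence "[:- \<psi> h, 1:] ^ Suc (order (\<psi> h) p) dvd p"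
      by (intro vanish[OF _ F]) auto
    thus False using order[OF p, of "\<psi> h"] by blast
  qed
  then obtain m where "m \<le> order (\<psi> h) p" "(deriv ^^ m) F h \<noteq> 0" by blast
  thus ?thesis unfolding zero_multiplicity_def
    by (intro INF_lower2[of m]) auto
qed

text \<open>Since \<psi> is positive and injective on S, the zeros of F in S correspond to the roots
  of p in the image of S, and the bounds on the single multiplicities add up. Counting only roots in
  the image makes it possible to discard a root outside it. If p = 0, then F vanishes on the open
  set S, where no zero is isolated. S may be one component of T, as happens for
  \<open>S1\<close>.\<close>

lemma isolated_zeros_poly_comp:
  fixes \<psi> F :: "real \<Rightarrow> real" and p :: "real poly" and N e :: int
  assumes S: "open S" and T: "S \<subseteq> T" and \<kappa>: "\<kappa> \<noteq> 0"
    and \<psi>_pos: "\<And>h. h \<in> S \<Longrightarrow> \<psi> h > 0"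
    and \<psi>_deriv: "\<And>h. h \<in> S \<Longrightarrow> (\<psi> has_real_derivative \<kappa> * \<psi> h powi e) (at h)"
    and \<psi>_inj: "inj_on \<psi> S"
    and F: "\<And>h. h \<in> S \<Longrightarrow> F h = poly p (\<psi> h) * \<psi> h powi N"
    and d: "(\<Sum>a | poly p a = 0 \<and> a \<in> \<psi> ` S. order a p) \<le> d \<or> p = 0"
  shows "finite (isolated_zeros F T \<inter> S) \<and>
    (\<Sum>h\<in>isolated_zeros F T \<inter> S. zero_multiplicity F h) \<le> enat d"
proof (cases "p = 0")
  case True
  have "isolated_zeros F T \<inter> S = {}"
  proof (rule ccontr)
    assume "isolated_zeros F T \<inter> S \<noteq> {}"
    then obtain h where h: "h \<in> S" "\<forall>\<^sub>F t in at h within T. F t \<noteq> 0"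
      by (auto simp: isolated_zeros_def)
    have "at h within T = at h"
      using S T h(1) by (meson at_within_open_subset)
    with h(2) have "\<forall>\<^sub>F t in at h. F t \<noteq> 0" by simp
    moreover have "\<forall>\<^sub>F t in at h. t \<in> S"
      using S h(1) by (rule eventually_at_in_open')
    ultimately have "\<forall>\<^sub>F t in at h. False"
      by eventually_elim (simp add: F True)
    thus False by simp
  qed
  thus ?thesis by simp
next
  case False
  let ?Z = "isolated_zeros F T \<inter> S"
  let ?R = "{a. poly p a = 0 \<and> a \<in> \<psi> ` S}"
  have R: "finite ?R" using poly_roots_finite[OF False] by simp
  have sub: "\<psi> ` ?Z \<subseteq> ?R"
    using F \<psi>_pos by (fastforce simp: isolated_zeros_def)
  have inj: "inj_on \<psi> ?Z" using \<psi>_inj by (rule inj_on_subset) auto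
  have fin: "finite ?Z" using sub R inj by (meson finite_imageD finite_subset)
  have "(\<Sum>h\<in>?Z. zero_multiplicity F h) \<le> (\<Sum>h\<in>?Z. enat (order (\<psi> h) p))"
    by (intro sum_mono zero_multiplicity_poly_comp[OF S _ \<kappa> \<psi>_pos \<psi>_deriv F False]) auto
  also have "\<dots> = enat (\<Sum>h\<in>?Z. order (\<psi> h) p)"
    using fin by (induction rule: finite_induct) (auto simp: zero_enat_def)
  also have "(\<Sum>h\<in>?Z. order (\<psi> h) p) = (\<Sum>a\<in>\<psi> ` ?Z. order a p)"
    by (simp add: sum.reindex[OF inj])
  also have "enat \<dots> \<le> enat d"
    using sum_mono2[OF R sub, of "\<lambda>a. order a p"] d False by simp
  finally show ?thesis using fin by blast
qed

lemma sum_order_subset_le_degree: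
  assumes "p \<noteq> 0" "A \<subseteq> {x. poly p x = 0}"
  shows "(\<Sum>x\<in>A. order x p) \<le> degree p"
  using sum_mono2[OF poly_roots_finite[OF assms(1)] assms(2), of "\<lambda>x. order x p"]
    sum_order_le_degree[OF assms(1)] by simp

section \<open>Line integrals over graphs\<close>

text \<open>
  Along any admissible parametrization the abscissa is monotone from one end point to the other, so
  the fundamental theorem of calculus applied to \<open>\<Phi>\<close> yields both existence and uniqueness of the value.
\<close>

lemma graph_flow_integral:
  fixes y y' \<Phi> :: "real \<Rightarrow> real"
  assumes ab: "a < b" and \<sigma>: "\<sigma> = 1 \<or> \<sigma> = - 1"
    and y_cont: "continuous_on {a..b} y"
    and y_deriv: "\<And>x. x \<in> {a<..<b} \<Longrightarrow> (y has_real_derivative y' x) (at x)"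
    and y'_cont: "continuous_on {a<..<b} y'"
    and V_fst: "\<And>x. x \<in> {a<..<b} \<Longrightarrow> \<sigma> * fst (V (x, y x)) > 0"
    and V_snd: "\<And>x. x \<in> {a<..<b} \<Longrightarrow> snd (V (x, y x)) = y' x * fst (V (x, y x))"
    and \<Phi>_cont: "continuous_on {a..b} \<Phi>"
    and \<Phi>_deriv: "\<And>x. x \<in> {a<..<b} \<Longrightarrow>
      (\<Phi> has_real_derivative P x (y x) + Q x (y x) * y' x) (at x)"
  shows "flow_integral V ((\<lambda>x. (x, y x)) ` {a<..<b}) P Q = \<sigma> * (\<Phi> b - \<Phi> a)"
proof -
  let ?\<Gamma> = "(\<lambda>x. (x, y x)) ` {a<..<b}"
  have val: "has_line_integral P Q (\<sigma> * (\<Phi> b - \<Phi> a)) g" if g: "flow_parametrization V ?\<Gamma> g" for g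
  proof -
    define x where "x t = fst (g t)" for t
    have g_cont: "continuous_on {0..1} g"
      using g by (auto simp: flow_parametrization_def arc_def path_def)
    have x_cont: "continuous_on {0..1} x"
      unfolding x_def by (intro continuous_intros g_cont)
    have x_img: "x ` {0<..<1} = {a<..<b}"
    proof -
      have "x ` {0<..<1} = fst ` (g ` {0<..<1})" by (auto simp: x_def image_image)
      also have "\<dots> = {a<..<b}" using g by (simp add: flow_parametrization_def image_image)
      finally show ?thesis .
    qed
    have x_in: "x t \<in> {a<..<b}" if "t \<in> {0<..<1}" for t using x_img that by blast
    have g_eq: "g t = (x t, y (x t))" if "t \<in> {0<..<1}" for t
    proof -
      have "g t \<in> ?\<Gamma>" using g that by (auto simp: flow_parametrization_def)
      thus ?thesis by (auto simp: x_def)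
    qed
    define x' where "x' t = fst (vector_derivative g (at t))" for t
    have g_vd: "(g has_vector_derivative vector_derivative g (at t)) (at t)" if "t \<in> {0<..<1}" for t
      using g that by (auto simp: flow_parametrization_def C1_differentiable_on_eq vector_derivative_works)
    have x_deriv: "(x has_real_derivative x' t) (at t)" if "t \<in> {0<..<1}" for t
    proof -
      have "((\<lambda>t. fst (g t)) has_vector_derivative fst (vector_derivative g (at t))) (at t)"
        using g_vd[OF that] by (auto simp: has_vector_derivative_def intro!: derivative_eq_intros)
      thus ?thesis
        unfolding x_def[abs_def] x'_def has_real_derivative_iff_has_vector_derivative .
    qed
    have vd: "\<sigma> * x' t > 0 \<and> snd (vector_derivative g (at t)) = y' (x t) * x' t" if t: "t \<in> {0<..<1}" for t
    proof -
      obtain c where c: "c > 0" "vector_derivative g (at t) = c *\<^sub>R V (g t)"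
        using g t unfolding flow_parametrization_def by blast
      have "0 < c * (\<sigma> * fst (V (x t, y (x t))))" using c V_fst[OF x_in[OF t]] by simp
      also have "\<dots> = \<sigma> * x' t" using c(2) g_eq[OF t] by (simp add: x'_def)
      finally have "\<sigma> * x' t > 0" .
      thus ?thesis using c(2) V_snd[OF x_in[OF t]] g_eq[OF t] by (simp add: x'_def)
    qed
    have mono: "\<sigma> * x s < \<sigma> * x t" if "0 \<le> s" "s < t" "t \<le> 1" for s t
    proof (rule DERIV_pos_imp_increasing_open[OF that(2)])
      fix r assume "s < r" "r < t"
      hence r: "r \<in> {0<..<1}" using that by auto
      show "\<exists>d. ((\<lambda>r. \<sigma> * x r) has_real_derivative d) (at r) \<and> 0 < d"
        using DERIV_cmult[OF x_deriv[OF r], of \<sigma>] vd[OF r] by blast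
    next
      show "continuous_on {s..t} (\<lambda>r. \<sigma> * x r)"
        using continuous_on_subset[OF x_cont, of "{s..t}"] that
        by (simp add: continuous_on_mult_left)
    qed
    \<comment> \<open>The position of g at t = 0 and t = 1 is not prescribed by the definition.
      Continuity places the abscissa in the closed interval, and strict monotonicity then forces it
      to be an end point.\<close>
    have cl: "x t \<in> {a..b}" if "t \<in> {0..1}" for t
    proof -
      have "x ` closure {0<..<1} \<subseteq> closure (x ` {0<..<1})"
        by (intro image_closure_subset closed_closure closure_subset) (use x_cont in simp)
      thus ?thesis using that ab by (simp add: x_img image_subset_iff)
    qed
    have ends: "\<sigma> * (\<Phi> b - \<Phi> a) = \<Phi> (x 1) - \<Phi> (x 0)"
    proof -
      have lim: "\<sigma> * x 0 < \<sigma> * z \<and> \<sigma> * z < \<sigma> * x 1" if "z \<in> {a<..<b}" for z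
      proof -
        have "z \<in> x ` {0<..<1}" using x_img that by simp
        then obtain t where "t \<in> {0<..<1}" "z = x t" by (rule imageE)
        thus ?thesis using mono[of 0 t] mono[of t 1] by simp
      qed
      have c0: "x 0 \<in> {a..b}" "x 1 \<in> {a..b}" using cl by auto
      show ?thesis
      proof (cases "\<sigma> = 1")
        case True
        have "x 0 \<le> a" by (rule dense_ge_bounded[OF ab]) (use lim True in \<open>simp add: less_imp_le\<close>)
        moreover have "b \<le> x 1" by (rule dense_le_bounded[OF ab]) (use lim True in \<open>simp add: less_imp_le\<close>)
        ultimately have "x 0 = a" "x 1 = b" using c0 by auto
        thus ?thesis using True by simp
      next
        case False
        hence s: "\<sigma> = -1" using \<sigma> by auto
        have "x 1 \<le> a" by (rule dense_ge_bounded[OF ab]) (use lim s in \<open>simp add: less_imp_le\<close>)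
        moreover have "b \<le> x 0" by (rule dense_le_bounded[OF ab]) (use lim s in \<open>simp add: less_imp_le\<close>)
        ultimately have "x 1 = a" "x 0 = b" using c0 by auto
        thus ?thesis using s by simp
      qed
    qed
    have "((\<lambda>t. P (fst (g t)) (snd (g t)) * fst (vector_derivative g (at t))
         + Q (fst (g t)) (snd (g t)) * snd (vector_derivative g (at t))) has_integral \<Phi> (x 1) - \<Phi> (x 0)) {0..1}"
    \<comment> \<open>Derivatives are available only inside the interval: g need not be
      differentiable at the ends of the arc, and for the ovals y' is unbounded there.\<close>
    proof (rule fundamental_theorem_of_calculus_interior)
      show "continuous_on {0..1} (\<lambda>t. \<Phi> (x t))"
        by (rule continuous_on_compose2[OF \<Phi>_cont x_cont]) (use cl in auto)
      fix t :: real assume t: "t \<in> {0<..<1}"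
      have "((\<lambda>t. \<Phi> (x t)) has_real_derivative (P (x t) (y (x t)) + Q (x t) (y (x t)) * y' (x t)) * x' t) (at t)"
        by (rule DERIV_chain2[OF \<Phi>_deriv[OF x_in[OF t]] x_deriv[OF t]])
      thus "((\<lambda>t. \<Phi> (x t)) has_vector_derivative P (fst (g t)) (snd (g t)) * fst (vector_derivative g (at t))
         + Q (fst (g t)) (snd (g t)) * snd (vector_derivative g (at t))) (at t)"
        using vd[OF t] g_eq[OF t]
        by (simp add: has_real_derivative_iff_has_vector_derivative x'_def[symmetric] algebra_simps)
    qed simp
    thus ?thesis unfolding has_line_integral_def ends .
  qed
  \<comment> \<open>Existence is shown with an affine abscissa that starts at a or at b according to
    the sign \<sigma> of dx/dt along the field.\<close>
  define m where "m = (if \<sigma> = 1 then a else b)"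
  define k where "k = \<sigma> * (b - a)"
  define \<xi> where "\<xi> t = m + k * t" for t
  have k: "k \<noteq> 0" "\<sigma> * k > 0" using ab \<sigma> by (auto simp: k_def)
  have \<xi>_open: "\<xi> t \<in> {a<..<b}" if "t \<in> {0<..<1}" for t
    using that ab \<sigma> mult_strict_left_mono[of t 1 "b - a"] mult_pos_pos[of "b - a" t]
    by (auto simp: \<xi>_def m_def k_def algebra_simps)
  have \<xi>_closed: "\<xi> t \<in> {a..b}" if "t \<in> {0..1}" for t
    using that ab \<sigma> mult_left_mono[of t 1 "b - a"] mult_nonneg_nonneg[of "b - a" t]
    by (auto simp: \<xi>_def m_def k_def algebra_simps)
  have \<xi>_img: "\<xi> ` {0<..<1} = {a<..<b}"
  proof (intro equalityI subsetI)
    fix z assume z: "z \<in> {a<..<b}"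
    have "(z - m) / k \<in> {0<..<1}"
      using z ab \<sigma> by (auto simp: m_def k_def field_simps)
    moreover have "z = \<xi> ((z - m) / k)" using k by (simp add: \<xi>_def)
    ultimately show "z \<in> \<xi> ` {0<..<1}" by blast
  qed (use \<xi>_open in auto)
  have \<xi>_cont: "continuous_on X \<xi>" for X
    unfolding \<xi>_def[abs_def] by (intro continuous_intros)
  define g where "g t = (\<xi> t, y (\<xi> t))" for t
  have g_deriv: "(g has_vector_derivative (k, y' (\<xi> t) * k)) (at t)" if "t \<in> {0<..<1}" for t
  proof -
    have 1: "(\<xi> has_real_derivative k) (at t)"
      unfolding \<xi>_def by (auto intro!: derivative_eq_intros)
    show ?thesis unfolding g_def
      using 1 DERIV_chain2[OF y_deriv[OF \<xi>_open[OF that]] 1]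
      by (intro has_vector_derivative_Pair) (auto simp: has_real_derivative_iff_has_vector_derivative)
  qed
  have "flow_parametrization V ?\<Gamma> g"
    unfolding flow_parametrization_def
  proof (intro conjI ballI)
    have "continuous_on {0..1} g" unfolding g_def
      by (intro continuous_on_Pair continuous_on_compose2[OF y_cont \<xi>_cont] \<xi>_cont)
        (use \<xi>_closed in blast)
    moreover have "inj_on g {0..1}" using k by (auto simp: inj_on_def g_def \<xi>_def)
    ultimately show "arc g" by (simp add: arc_def path_def)
    show "g ` {0<..<1} = ?\<Gamma>"
      unfolding \<xi>_img[symmetric] by (simp add: g_def image_image)
    have "continuous_on {0<..<1} (\<lambda>t. (k, y' (\<xi> t) * k))"
      by (intro continuous_on_Pair continuous_on_mult_right continuous_on_const
          continuous_on_compose2[OF y'_cont \<xi>_cont]) (use \<xi>_open in blast)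
    thus "g C1_differentiable_on {0<..<1}"
      unfolding C1_differentiable_on_def
      by (intro exI[of _ "\<lambda>t. (k, y' (\<xi> t) * k)"]) (use g_deriv in simp)
    fix t :: real assume t: "t \<in> {0<..<1}"
    define F where "F = fst (V (g t))"
    have F: "\<sigma> * F > 0" "V (g t) = (F, y' (\<xi> t) * F)"
      using V_fst[OF \<xi>_open[OF t]] V_snd[OF \<xi>_open[OF t]] by (auto simp: F_def g_def prod_eq_iff)
    have "k / F > 0" using F(1) k(2) \<sigma> by (auto simp: zero_less_divide_iff)
    moreover have "vector_derivative g (at t) = (k / F) *\<^sub>R V (g t)"
      using vector_derivative_at[OF g_deriv[OF t]] F by auto
    ultimately show "\<exists>c>0. vector_derivative g (at t) = c *\<^sub>R V (g t)" by blast
  qed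
  note g = this
  show ?thesis unfolding flow_integral_def
  proof (rule the_equality)
    show "\<exists>g. flow_parametrization V ?\<Gamma> g \<and> has_line_integral P Q (\<sigma> * (\<Phi> b - \<Phi> a)) g"
      using g val by blast
    fix I assume "\<exists>g. flow_parametrization V ?\<Gamma> g \<and> has_line_integral P Q I g"
    then obtain g where "flow_parametrization V ?\<Gamma> g" "has_line_integral P Q I g" by blast
    with val[of g] show "I = \<sigma> * (\<Phi> b - \<Phi> a)"
      unfolding has_line_integral_def by (blast intro: has_integral_unique)
  qed
qed

section \<open>Abelian integrals as combinations of integrals over ovals\<close>

definition rpow_dom :: "real \<Rightarrow> real set" where
  "rpow_dom r = (if r \<in> \<int> then {x. x \<noteq> 0} else {x. x > 0})"

lemma rpow_dom_nonzero: "x \<in> rpow_dom r \<Longrightarrow> x \<noteq> 0"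
  by (auto simp: rpow_dom_def split: if_splits)

lemma xdom_eq_rpow_dom: "xdom s = rpow_dom (kexp s)"
  by (simp add: xdom_def rpow_dom_def)

lemma rpow_dom_uminus: "rpow_dom (- r) = rpow_dom r"
  by (simp add: rpow_dom_def)

text \<open>The domain depends only on whether the exponent is an integer. It is therefore common to
  the exponents k, -k, -k - 1 and -k - 2, and one domain serves for all powers of x that
  arise.\<close>

lemma rpow_dom_diff_1: "rpow_dom (r - 1) = rpow_dom r"
proof -
  have "r - 1 \<in> \<int> \<longleftrightarrow> r \<in> \<int>"
    by (metis Ints_1 Ints_add Ints_diff diff_add_cancel)
  thus ?thesis by (simp add: rpow_dom_def)
qed

lemma rpow_has_real_derivative:
  assumes "x \<in> rpow_dom r"
  shows "((\<lambda>x. rpow x r) has_real_derivative r * rpow x (r - 1)) (at x)"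
proof (cases "r \<in> \<int>")
  case True
  then obtain n where n: "r = of_int n" by (elim Ints_cases)
  have "x \<noteq> 0" using assms by (rule rpow_dom_nonzero)
  hence "((\<lambda>x. x powi n) has_real_derivative of_int n * x powi (n - 1)) (at x)"
    by (auto intro!: derivative_eq_intros)
  moreover have "r - 1 = of_int (n - 1)" by (simp add: n)
  hence "rpow x (r - 1) = x powi (n - 1)" for x unfolding rpow_def by (metis Ints_of_int floor_of_int)
  moreover have "rpow x r = x powi n" for x by (simp add: rpow_def n)
  ultimately show ?thesis by (simp add: n)
next
  case False
  hence "r - 1 \<notin> \<int>" by (metis Ints_1 Ints_add diff_add_cancel)
  moreover have "x > 0" using assms False by (simp add: rpow_dom_def)
  ultimately show ?thesis using False
    by (simp add: rpow_def has_real_derivative_powr)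
qed

lemma rpow_diff_1:
  assumes "x \<in> rpow_dom r"
  shows "rpow x r = x * rpow x (r - 1)"
proof (cases "r \<in> \<int>")
  case True
  then obtain n where n: "r = of_int n" by (elim Ints_cases)
  have "x \<noteq> 0" using assms by (rule rpow_dom_nonzero)
  hence "x powi n = x * x powi (n - 1)" by (simp add: power_int_diff)
  moreover have "r - 1 = of_int (n - 1)" by (simp add: n)
  hence "rpow x (r - 1) = x powi (n - 1)" unfolding rpow_def by (metis Ints_of_int floor_of_int)
  ultimately show ?thesis by (simp add: rpow_def n)
next
  case False
  hence "r - 1 \<notin> \<int>" by (metis Ints_1 Ints_add diff_add_cancel)
  moreover have "x > 0" using assms False by (simp add: rpow_dom_def)
  ultimately show ?thesis using False by (simp add: rpow_def powr_diff)
qed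

lemma rpow_mult_uminus:
  assumes "x \<in> rpow_dom r"
  shows "rpow x r * rpow x (- r) = 1"
proof (cases "r \<in> \<int>")
  case True
  then obtain n where n: "r = of_int n" by (elim Ints_cases)
  have "x \<noteq> 0" using assms by (rule rpow_dom_nonzero)
  moreover have "- r = of_int (- n)" by (simp add: n)
  hence "rpow x (- r) = x powi (- n)" unfolding rpow_def by (metis Ints_of_int floor_of_int)
  ultimately show ?thesis by (simp add: rpow_def n power_int_minus)
next
  case False
  hence "- r \<notin> \<int>" by simp
  moreover have "x > 0" using assms False by (simp add: rpow_dom_def)
  ultimately show ?thesis using False by (simp add: rpow_def powr_minus)
qed

text \<open>Solving H = h for y^2 gives this function, so the two arcs are the graphs of its
  positive and negative square root over \<open>oval\<close>.\<close>

definition Wfun :: "system \<Rightarrow> real \<Rightarrow> real \<Rightarrow> real" where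
  "Wfun s h x = 2 * (h * rpow x (kexp s) - lam2 s * x^2 - lam1 s * x - lam0 s)"

definition oval :: "system \<Rightarrow> real \<Rightarrow> real set" where
  "oval s h = {x \<in> xdom s. Wfun s h x > 0}"

text \<open>The exponent -k - 2 comes from the integration by parts, which differentiates x^(-k -
  1). A dx term with x^i consequently appears with index i + 1. The square root is the absolute
  value of y; the sign of y^j is supplied where the arcs are combined.\<close>

definition oval_integral :: "system \<Rightarrow> nat \<Rightarrow> nat \<Rightarrow> real \<Rightarrow> real" where
  "oval_integral s i j h =
     integral (oval s h) (\<lambda>x. rpow x (- kexp s - 2) * x ^ i * sqrt (Wfun s h x) ^ j)"

text \<open>In all four systems dx/dt is a constant times x y. This constant and the sign of x
  decide the direction in which the upper and the lower arc are traversed.\<close>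

primrec speed :: "system \<Rightarrow> real" where
  "speed S1 = sqrt 2" | "speed S2 = sqrt 2 / 2" | "speed R19 = - 1" | "speed R20 = - 1"

lemma fst_vfield: "fst (vfield s (x, y)) = speed s * x * y"
  by (cases s) auto

lemma Hfun_eq_iff:
  assumes "x \<in> xdom s"
  shows "Hfun s x y = h \<longleftrightarrow> y^2 = Wfun s h x"
proof -
  have r: "rpow x (kexp s) * rpow x (- kexp s) = 1"
    using assms by (intro rpow_mult_uminus) (simp add: xdom_eq_rpow_dom)
  define q where "q = 1/2 * y^2 + lam2 s * x^2 + lam1 s * x + lam0 s"
  have "rpow x (- kexp s) * q = h \<longleftrightarrow> q = h * rpow x (kexp s)"
    using r by (metis mult.assoc mult.commute mult.left_neutral)
  also have "\<dots> \<longleftrightarrow> y^2 = Wfun s h x"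
    by (auto simp: q_def Wfun_def field_simps)
  finally show ?thesis by (simp add: Hfun_def q_def)
qed

lemma Wfun_has_real_derivative:
  assumes "x \<in> xdom s"
  shows "(Wfun s h has_real_derivative
    2 * (h * (kexp s * rpow x (kexp s - 1)) - 2 * lam2 s * x - lam1 s)) (at x)"
  unfolding Wfun_def[abs_def] using assms
  by (auto intro!: derivative_eq_intros rpow_has_real_derivative simp: xdom_eq_rpow_dom)

text \<open>The parenthesis is half the derivative of \<open>Wfun\<close>, which is y y' along the
  arc. Together with the formula for dx/dt this expresses that the field is tangent to the level
  curve. Eliminating h by the equation of the curve leaves a polynomial identity for each
  system.\<close>

lemma snd_vfield:
  assumes "x \<in> xdom s" "y^2 = Wfun s h x"
  shows "snd (vfield s (x, y)) =
    speed s * x * (h * (kexp s * rpow x (kexp s - 1)) - 2 * lam2 s * x - lam1 s)"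
proof -
  have "h * rpow x (kexp s) = y^2 / 2 + lam2 s * x^2 + lam1 s * x + lam0 s"
    unfolding assms(2) Wfun_def by (simp add: field_simps)
  moreover have "rpow x (kexp s) = x * rpow x (kexp s - 1)"
    using assms(1) by (intro rpow_diff_1) (simp add: xdom_eq_rpow_dom)
  ultimately have E: "h * (x * rpow x (kexp s - 1)) = y^2 / 2 + lam2 s * x^2 + lam1 s * x + lam0 s"
    by simp
  have "speed s * x * (h * (kexp s * D) - 2 * lam2 s * x - lam1 s) =
    speed s * (kexp s * (h * (x * D)) - 2 * lam2 s * x^2 - lam1 s * x)" for D
    by (simp add: algebra_simps power2_eq_square)
  from this[of "rpow x (kexp s - 1)", unfolded E]
  have "speed s * x * (h * (kexp s * rpow x (kexp s - 1)) - 2 * lam2 s * x - lam1 s) =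
    speed s * (kexp s * (y^2 / 2 + lam2 s * x^2 + lam1 s * x + lam0 s) - 2 * lam2 s * x^2 - lam1 s * x)" .
  also have "\<dots> = snd (vfield s (x, y))"
    by (cases s) (simp_all add: field_simps power2_eq_square)
  finally show ?thesis by simp
qed

section \<open>Flow integrals over the arcs and their sum\<close>

lemma finite_degree_le: "finite {(i, j). i + j \<le> (n :: nat)}"
  by (rule finite_subset[of _ "{..n} \<times> {..n}"]) auto

text \<open>The sign of y on the arc is \<epsilon> and the sign of dx/dt there is \<epsilon> \<tau>,
  so the upper and the lower arc can be treated by one argument.\<close>

lemma flow_integral_arc:
  fixes f g :: "nat \<Rightarrow> nat \<Rightarrow> real" and n :: nat
  assumes ab: "a < b" and dom: "{a..b} \<subseteq> xdom s" and oval: "oval s h = {a<..<b}"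
    and ends: "Wfun s h a = 0" "Wfun s h b = 0"
    and \<tau>: "\<tau> = 1 \<or> \<tau> = - 1" and \<tau>_sgn: "\<And>x. x \<in> {a<..<b} \<Longrightarrow> \<tau> * (speed s * x) > 0"
    and \<epsilon>: "\<epsilon> = 1 \<or> \<epsilon> = - 1"
  shows "flow_integral (vfield s) {(x, y). x \<in> xdom s \<and> Hfun s x y = h \<and> \<epsilon> * y > 0}
     (\<lambda>x y. rpow x (- kexp s - 1) * poly2 n g x y) (\<lambda>x y. - (rpow x (- kexp s - 1) * poly2 n f x y))
   = \<epsilon> * \<tau> * (\<Sum>(i, j) | i + j \<le> n. g i j * (\<epsilon> ^ j * oval_integral s (i + 1) j h)
       + (real i - kexp s - 1) / real (j + 1) * f i j * (\<epsilon> ^ (j + 1) * oval_integral s i (j + 1) h))"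
proof -
  define k where "k = kexp s"
  define W where "W = Wfun s h"
  define W' where "W' x = 2 * (h * (k * rpow x (k - 1)) - 2 * lam2 s * x - lam1 s)" for x
  define y where "y x = \<epsilon> * sqrt (W x)" for x
  define y' where "y' x = \<epsilon> * (W' x * inverse (sqrt (W x)) / 2)" for x
  define S where "S = {(i, j). i + j \<le> n}"
  have \<epsilon>2: "\<epsilon> * \<epsilon> = 1" using \<epsilon> by auto
  have fin: "finite S" unfolding S_def by (rule finite_degree_le)
  have p2: "poly2 n c u v = (\<Sum>p\<in>S. c (fst p) (snd p) * u ^ fst p * v ^ snd p)" for c u v
    by (simp add: poly2_def S_def case_prod_unfold)
  have dom': "x \<in> xdom s" if "x \<in> {a..b}" for x using dom that by auto
  have doms: "rpow_dom (k - 1) = xdom s" "rpow_dom (- k - 1) = xdom s" "rpow_dom (- k - 2) = xdom s"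
    using rpow_dom_diff_1[of k] rpow_dom_diff_1[of "- k"] rpow_dom_diff_1[of "- k - 1"]
    unfolding diff_diff_eq one_add_one
    by (simp_all add: xdom_eq_rpow_dom k_def[symmetric] rpow_dom_uminus)
  have rpow_cont: "continuous_on {a..b} (\<lambda>x. rpow x r)" if "rpow_dom r = xdom s" for r
    by (rule DERIV_continuous_on[OF has_field_derivative_at_within[OF rpow_has_real_derivative]])
      (use dom' that in blast)
  have W_pos: "W x > 0" if "x \<in> {a<..<b}" for x
    using that oval unfolding W_def oval_def by blast
  have W_deriv: "(W has_real_derivative W' x) (at x)" if "x \<in> {a..b}" for x
    using Wfun_has_real_derivative[OF dom'[OF that]] by (simp add: W_def W'_def[abs_def] k_def)
  have W_cont: "continuous_on {a..b} W"
    by (rule DERIV_continuous_on[OF has_field_derivative_at_within[OF W_deriv]])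
  have y_cont: "continuous_on {a..b} y"
    unfolding y_def[abs_def] by (intro continuous_intros W_cont)
  have y_deriv: "(y has_real_derivative y' x) (at x)" if x: "x \<in> {a<..<b}" for x
  proof -
    have "((\<lambda>x. sqrt (W x)) has_real_derivative inverse (sqrt (W x)) / 2 * W' x) (at x)"
      by (rule DERIV_chain2[OF DERIV_real_sqrt[OF W_pos[OF x]] W_deriv]) (use x in auto)
    from DERIV_cmult[OF this, of \<epsilon>] show ?thesis by (simp add: y_def[abs_def] y'_def mult_ac)
  qed
  have y'_cont: "continuous_on {a<..<b} y'"
  proof -
    have "continuous_on {a<..<b} (\<lambda>x. rpow x (k - 1))"
      by (rule continuous_on_subset[OF rpow_cont[OF doms(1)]]) auto
    moreover have "continuous_on {a<..<b} W" by (rule continuous_on_subset[OF W_cont]) auto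
    ultimately show ?thesis unfolding y'_def[abs_def] W'_def
      by (intro continuous_intros) (use W_pos in force)+
  qed
  have y_sq: "y x ^ 2 = W x" if "x \<in> {a<..<b}" for x
    using W_pos[OF that] \<epsilon> by (auto simp: y_def power_mult_distrib)
  have y_ends: "y a = 0" "y b = 0" using ends by (auto simp: y_def W_def)
  have arc: "{(x, y). x \<in> xdom s \<and> Hfun s x y = h \<and> \<epsilon> * y > 0} = (\<lambda>x. (x, y x)) ` {a<..<b}"
  proof (intro equalityI subsetI)
    fix z assume "z \<in> {(x, y). x \<in> xdom s \<and> Hfun s x y = h \<and> \<epsilon> * y > 0}"
    then obtain u v where z: "z = (u, v)" "u \<in> xdom s" "Hfun s u v = h" "\<epsilon> * v > 0" by auto
    have v2: "v^2 = W u" using Hfun_eq_iff[OF z(2)] z(3) by (simp add: W_def)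
    have "v \<noteq> 0" using z(4) by auto
    hence "W u > 0" using v2 by (metis zero_less_power2)
    hence u: "u \<in> {a<..<b}" using z(2) oval by (auto simp: oval_def W_def)
    have "sqrt (W u) = \<epsilon> * v"
    proof (rule real_sqrt_unique)
      have "(\<epsilon> * v)^2 = (\<epsilon> * \<epsilon>) * v^2" by (simp add: power2_eq_square mult_ac)
      thus "(\<epsilon> * v)^2 = W u" using \<epsilon>2 v2 by simp
    qed (use z(4) in simp)
    hence "v = y u" using \<epsilon>2 by (simp add: y_def flip: mult.assoc)
    thus "z \<in> (\<lambda>x. (x, y x)) ` {a<..<b}" using z u by auto
  next
    fix z assume "z \<in> (\<lambda>x. (x, y x)) ` {a<..<b}"
    then obtain x where x: "z = (x, y x)" "x \<in> {a<..<b}" by auto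
    have "x \<in> xdom s" using dom' x(2) by auto
    moreover have "Hfun s x (y x) = h" using Hfun_eq_iff[OF \<open>x \<in> xdom s\<close>] y_sq[OF x(2)] by (simp add: W_def)
    moreover have "\<epsilon> * y x > 0" using W_pos[OF x(2)] \<epsilon>2 by (simp add: y_def flip: mult.assoc)
    ultimately show "z \<in> {(x, y). x \<in> xdom s \<and> Hfun s x y = h \<and> \<epsilon> * y > 0}" using x by auto
  qed
  define \<rho> where "\<rho> i j x = rpow x (- k - 2) * x ^ i * y x ^ j" for i j x
  define R where "R x = (\<Sum>p\<in>S. g (fst p) (snd p) * \<rho> (fst p + 1) (snd p) x +
    (real (fst p) - k - 1) / real (snd p + 1) * f (fst p) (snd p) * \<rho> (fst p) (snd p + 1) x)" for x
  \<comment> \<open>This is the boundary term of the integration by parts. It vanishes at a and b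
    because y does, and it removes y', which is unbounded near the end points, so that only the
    continuous integrand \<open>R\<close> remains.\<close>
  define B where "B x = (\<Sum>p\<in>S. f (fst p) (snd p) / real (snd p + 1) *
    (rpow x (- k - 1) * x ^ fst p * y x ^ (snd p + 1)))" for x
  define \<Phi> where "\<Phi> x = integral {a..x} R - B x" for x
  have \<rho>_cont: "continuous_on {a..b} (\<rho> i j)" for i j
    unfolding \<rho>_def[abs_def] by (intro continuous_intros y_cont rpow_cont doms)
  have R_cont: "continuous_on {a..b} R"
    unfolding R_def[abs_def] by (intro continuous_intros \<rho>_cont)
  have B_cont: "continuous_on {a..b} B"
    unfolding B_def[abs_def] by (intro continuous_intros rpow_cont y_cont doms)
  have \<Phi>_cont: "continuous_on {a..b} \<Phi>"
    unfolding \<Phi>_def[abs_def]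
    by (intro continuous_on_diff B_cont indefinite_integral_continuous_1 integrable_continuous_interval R_cont)
  have B_deriv: "(B has_real_derivative R x - (rpow x (- k - 1) * poly2 n g x (y x)
      + (- (rpow x (- k - 1) * poly2 n f x (y x))) * y' x)) (at x)" if x: "x \<in> {a<..<b}" for x
  proof -
    have xd: "x \<in> xdom s" using dom' x by auto
    have x0: "x \<noteq> 0" using rpow_dom_nonzero xd by (auto simp: xdom_eq_rpow_dom)
    have xr: "x \<in> rpow_dom (- k - 1)" using xd doms by simp
    have r1: "rpow x (- k - 1) = x * rpow x (- k - 2)"
      using rpow_diff_1[OF xr] unfolding diff_diff_eq one_add_one .
    have t: "((\<lambda>x. rpow x (- k - 1) * x ^ i * y x ^ (j + 1)) has_real_derivative
      (real i - k - 1) * \<rho> i (j + 1) x + real (j + 1) * (rpow x (- k - 1) * x ^ i * y x ^ j * y' x)) (at x)" for i j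
    proof -
      have 1: "((\<lambda>x. rpow x (- k - 1)) has_real_derivative (- k - 1) * rpow x (- k - 2)) (at x)"
        using rpow_has_real_derivative[OF xr] unfolding diff_diff_eq one_add_one .
      have 2: "((\<lambda>x. x ^ i) has_real_derivative real i * x ^ (i - 1)) (at x)"
        using DERIV_pow[of i x] by simp
      have 3: "((\<lambda>x. y x ^ (j + 1)) has_real_derivative real (j + 1) * (y x ^ j * y' x)) (at x)"
        using DERIV_power[OF y_deriv[OF x], of "j + 1"] by (simp add: mult_ac)
      have i: "x * (real i * x ^ (i - 1)) = real i * x ^ i" by (cases i) auto
      have "((\<lambda>x. rpow x (- k - 1) * x ^ i * y x ^ (j + 1)) has_real_derivative
        (((- k - 1) * rpow x (- k - 2)) * x ^ i + (real i * x ^ (i - 1)) * rpow x (- k - 1)) * y x ^ (j + 1)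
          + (real (j + 1) * (y x ^ j * y' x)) * (rpow x (- k - 1) * x ^ i)) (at x)"
        by (rule DERIV_mult[OF DERIV_mult[OF 1 2] 3])
      also have "(real i * x ^ (i - 1)) * rpow x (- k - 1) = real i * x ^ i * rpow x (- k - 2)"
        unfolding r1 i[symmetric] by simp
      finally show ?thesis by (simp add: \<rho>_def algebra_simps)
    qed
    have "(B has_real_derivative (\<Sum>p\<in>S. f (fst p) (snd p) / real (snd p + 1) *
      ((real (fst p) - k - 1) * \<rho> (fst p) (snd p + 1) x
        + real (snd p + 1) * (rpow x (- k - 1) * x ^ fst p * y x ^ snd p * y' x)))) (at x)"
      unfolding B_def[abs_def] by (intro DERIV_sum DERIV_cmult t)
    moreover have "(\<Sum>p\<in>S. f (fst p) (snd p) / real (snd p + 1) *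
      ((real (fst p) - k - 1) * \<rho> (fst p) (snd p + 1) x
        + real (snd p + 1) * (rpow x (- k - 1) * x ^ fst p * y x ^ snd p * y' x))) =
      R x - (rpow x (- k - 1) * poly2 n g x (y x) + (- (rpow x (- k - 1) * poly2 n f x (y x))) * y' x)"
    proof -
      have "rpow x (- k - 1) * poly2 n g x (y x) = (\<Sum>p\<in>S. g (fst p) (snd p) * \<rho> (fst p + 1) (snd p) x)"
        by (simp add: p2 \<rho>_def r1 sum_distrib_left mult_ac)
      moreover have "rpow x (- k - 1) * poly2 n f x (y x) * y' x =
        (\<Sum>p\<in>S. f (fst p) (snd p) * (rpow x (- k - 1) * x ^ fst p * y x ^ snd p * y' x))"
        by (simp add: p2 sum_distrib_left sum_distrib_right mult_ac)
      moreover have "c / real (m + 1) * (u * v + real (m + 1) * w) = u / real (m + 1) * c * v + c * w" for c u v w m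
        by (simp add: field_simps)
      ultimately show ?thesis by (simp add: R_def sum.distrib)
    qed
    ultimately show ?thesis by simp
  qed
  have \<Phi>_deriv: "(\<Phi> has_real_derivative rpow x (- k - 1) * poly2 n g x (y x)
      + (- (rpow x (- k - 1) * poly2 n f x (y x))) * y' x) (at x)" if x: "x \<in> {a<..<b}" for x
  proof -
    have "((\<lambda>x. integral {a..x} R) has_real_derivative R x) (at x within {a..b})"
      by (rule integral_has_real_derivative[OF R_cont]) (use x in auto)
    hence "((\<lambda>x. integral {a..x} R) has_real_derivative R x) (at x)"
      using x by (simp add: at_within_Icc_at)
    from DERIV_diff[OF this B_deriv[OF x]] show ?thesis
      by (simp add: \<Phi>_def[abs_def])
  qed
  have "flow_integral (vfield s) {(x, y). x \<in> xdom s \<and> Hfun s x y = h \<and> \<epsilon> * y > 0}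
     (\<lambda>x y. rpow x (- k - 1) * poly2 n g x y) (\<lambda>x y. - (rpow x (- k - 1) * poly2 n f x y))
     = \<epsilon> * \<tau> * (\<Phi> b - \<Phi> a)"
    unfolding arc
  proof (rule graph_flow_integral[where P = "\<lambda>x y. rpow x (- k - 1) * poly2 n g x y"
        and Q = "\<lambda>x y. - (rpow x (- k - 1) * poly2 n f x y)", OF ab _ y_cont y_deriv y'_cont _ _ \<Phi>_cont \<Phi>_deriv])
    show "\<epsilon> * \<tau> = 1 \<or> \<epsilon> * \<tau> = - 1" using \<epsilon> \<tau> by auto
    fix x assume x: "x \<in> {a<..<b}"
    have sq: "sqrt (W x) > 0" using W_pos[OF x] by simp
    have "\<epsilon> * \<tau> * fst (vfield s (x, y x)) = (\<epsilon> * \<epsilon>) * (\<tau> * (speed s * x)) * sqrt (W x)"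
      by (simp add: fst_vfield y_def)
    also have "\<dots> > 0" using \<tau>_sgn[OF x] sq by (simp add: \<epsilon>2)
    finally show "\<epsilon> * \<tau> * fst (vfield s (x, y x)) > 0" .
    have "y' x * fst (vfield s (x, y x)) = (\<epsilon> * \<epsilon>) * (speed s * x * (W' x / 2)) * (inverse (sqrt (W x)) * sqrt (W x))"
      by (simp add: fst_vfield y_def y'_def)
    also have "\<dots> = speed s * x * (W' x / 2)" using sq \<epsilon>2 by simp
    also have "\<dots> = snd (vfield s (x, y x))"
      using snd_vfield[of x s "y x" h] dom'[of x] x y_sq[OF x] by (simp add: W'_def W_def k_def)
    finally show "snd (vfield s (x, y x)) = y' x * fst (vfield s (x, y x))" by simp
  qed
  also have "\<Phi> b - \<Phi> a = integral {a..b} R"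
    by (simp add: \<Phi>_def B_def y_ends)
  also have "\<dots> = (\<Sum>p\<in>S. g (fst p) (snd p) * integral {a..b} (\<rho> (fst p + 1) (snd p)) +
    (real (fst p) - k - 1) / real (snd p + 1) * f (fst p) (snd p) * integral {a..b} (\<rho> (fst p) (snd p + 1)))"
  proof -
    have int: "\<rho> i j integrable_on {a..b}" for i j by (intro integrable_continuous_interval \<rho>_cont)
    have "(R has_integral (\<Sum>p\<in>S. g (fst p) (snd p) * integral {a..b} (\<rho> (fst p + 1) (snd p)) +
    (real (fst p) - k - 1) / real (snd p + 1) * f (fst p) (snd p) * integral {a..b} (\<rho> (fst p) (snd p + 1)))) {a..b}"
      unfolding R_def[abs_def]
      by (intro has_integral_sum fin has_integral_add has_integral_mult_right integrable_integral int)
    thus ?thesis by (rule integral_unique)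
  qed
  finally have flow: "flow_integral (vfield s) {(x, y). x \<in> xdom s \<and> Hfun s x y = h \<and> \<epsilon> * y > 0}
     (\<lambda>x y. rpow x (- k - 1) * poly2 n g x y) (\<lambda>x y. - (rpow x (- k - 1) * poly2 n f x y)) =
    \<epsilon> * \<tau> * (\<Sum>p\<in>S. g (fst p) (snd p) * integral {a..b} (\<rho> (fst p + 1) (snd p)) +
    (real (fst p) - k - 1) / real (snd p + 1) * f (fst p) (snd p) * integral {a..b} (\<rho> (fst p) (snd p + 1)))" .
  have "integral {a..b} (\<rho> i j) = \<epsilon> ^ j * oval_integral s i j h" for i j
  proof -
    have "integral {a..b} (\<rho> i j) = integral {a..b} (\<lambda>x. \<epsilon> ^ j * (rpow x (- k - 2) * x ^ i * sqrt (W x) ^ j))"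
      by (simp add: \<rho>_def[abs_def] y_def power_mult_distrib mult_ac)
    also have "\<dots> = \<epsilon> ^ j * integral {a..b} (\<lambda>x. rpow x (- k - 2) * x ^ i * sqrt (W x) ^ j)"
      by (rule integral_mult_right)
    also have "integral {a..b} (\<lambda>x. rpow x (- k - 2) * x ^ i * sqrt (W x) ^ j) = oval_integral s i j h"
      by (simp add: oval_integral_def oval integral_open_interval_real k_def W_def)
    finally show ?thesis .
  qed
  with flow show ?thesis by (simp add: k_def S_def case_prod_unfold)
qed

text \<open>The arcs have opposite dx/dt and opposite y, so an integral with y^j carries the total
  factor \<tau> (1 - (-1)^j). Only odd powers of y survive: odd j in the dx terms, and even j in the
  dy terms, where the integration by parts has raised the power to j + 1.\<close>

lemma abelian_integral_eq:
  fixes f g :: "nat \<Rightarrow> nat \<Rightarrow> real" and n :: nat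
  assumes "a < b" "{a..b} \<subseteq> xdom s" "oval s h = {a<..<b}" "Wfun s h a = 0" "Wfun s h b = 0"
    and "\<tau> = 1 \<or> \<tau> = - 1" "\<And>x. x \<in> {a<..<b} \<Longrightarrow> \<tau> * (speed s * x) > 0"
  shows "abelian_integral s (poly2 n f) (poly2 n g) (poly2 n f) (poly2 n g) h
   = (\<Sum>(i, j) | i + j \<le> n. \<tau> * (1 - (- 1) ^ j) * g i j * oval_integral s (i + 1) j h
       + \<tau> * (1 + (- 1) ^ j) * ((real i - kexp s - 1) / real (j + 1)) * f i j * oval_integral s i (j + 1) h)"
proof -
  have "upper_arc s h = {(x, y). x \<in> xdom s \<and> Hfun s x y = h \<and> 1 * y > 0}"
    "lower_arc s h = {(x, y). x \<in> xdom s \<and> Hfun s x y = h \<and> - 1 * y > 0}"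
    by (auto simp: upper_arc_def lower_arc_def)
  hence "abelian_integral s (poly2 n f) (poly2 n g) (poly2 n f) (poly2 n g) h =
    (\<Sum>(i, j) | i + j \<le> n. \<tau> * (g i j * oval_integral s (i + 1) j h
       + (real i - kexp s - 1) / real (j + 1) * f i j * oval_integral s i (j + 1) h)) +
    (\<Sum>(i, j) | i + j \<le> n. - \<tau> * (g i j * ((- 1) ^ j * oval_integral s (i + 1) j h)
       + (real i - kexp s - 1) / real (j + 1) * f i j * ((- 1) ^ (j + 1) * oval_integral s i (j + 1) h)))"
    using flow_integral_arc[OF assms, of 1 n g f] flow_integral_arc[OF assms, of "- 1" n g f]
    by (simp only: abelian_integral_def sum_distrib_left case_prod_unfold) simp
  also have "\<dots> = (\<Sum>(i, j) | i + j \<le> n. \<tau> * (1 - (- 1) ^ j) * g i j * oval_integral s (i + 1) j h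
       + \<tau> * (1 + (- 1) ^ j) * ((real i - kexp s - 1) / real (j + 1)) * f i j * oval_integral s i (j + 1) h)"
    unfolding sum.distrib[symmetric]
  proof (intro sum.cong refl, clarify)
    fix i j
    have "\<tau> * (u + q * v * w) + - \<tau> * (g i j * (e * u') + q * v * (- 1 * e * w)) =
      \<tau> * u - \<tau> * e * (g i j * u') + \<tau> * (1 + e) * q * v * w" for u u' v w e q
      by (simp add: algebra_simps)
    thus "\<tau> * (g i j * oval_integral s (i + 1) j h
       + (real i - kexp s - 1) / real (j + 1) * f i j * oval_integral s i (j + 1) h) +
       - \<tau> * (g i j * ((- 1) ^ j * oval_integral s (i + 1) j h)
       + (real i - kexp s - 1) / real (j + 1) * f i j * ((- 1) ^ (j + 1) * oval_integral s i (j + 1) h)) =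
       \<tau> * (1 - (- 1) ^ j) * g i j * oval_integral s (i + 1) j h
       + \<tau> * (1 + (- 1) ^ j) * ((real i - kexp s - 1) / real (j + 1)) * f i j * oval_integral s i (j + 1) h"
      by (simp only: power_Suc Suc_eq_plus1[symmetric]) (simp add: left_diff_distrib right_diff_distrib mult_ac)
  qed
  finally show ?thesis .
qed

section \<open>Integrals over a conic\<close>

text \<open>The limits are the two zeros of 2 c u - u^2 - 1, whose product is 1; the square root is
  v on the upper half of the conic.\<close>

definition conic_integral :: "int \<Rightarrow> nat \<Rightarrow> real \<Rightarrow> real" where
  "conic_integral l j c = integral {c - sqrt (c^2 - 1)..c + sqrt (c^2 - 1)}
     (\<lambda>u. u powi l * sqrt (2 * c * u - u^2 - 1) ^ j)"

text \<open>For r = cosh \<theta> and s = sinh \<theta> the left side is 2 cosh ((2 m + 1)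
  \<theta>), so T is of Chebyshev type. It arises from the three-term recurrence for the powers of A
  = r + s and B = r - s, where A B = 1 and A^2 + B^2 = 2 + 4 s^2.\<close>

lemma odd_power_sum_poly:
  "\<exists>T. degree T \<le> m \<and> (\<forall>r s :: real. r^2 = 1 + s^2 \<longrightarrow>
     (r + s) ^ (2 * m + 1) + (r - s) ^ (2 * m + 1) = 2 * r * poly T (s^2))"
proof (induction m rule: nat_less_induct)
  case (1 m)
  consider "m = 0" | "m = 1" | k where "m = Suc (Suc k)" by (metis One_nat_def not0_implies_Suc)
  thus ?case
  proof cases
    case 1
    thus ?thesis by (intro exI[of _ "1"]) auto
  next
    case 2
    have "(r + s) ^ 3 + (r - s) ^ 3 = 2 * r * (1 + s^2 * 4)" if "r^2 = 1 + s^2" for r s :: real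
    proof -
      have "(r + s) ^ 3 + (r - s) ^ 3 = 2 * r * (r^2 + 3 * s^2)"
        by (simp add: power2_eq_square power3_eq_cube algebra_simps)
      thus ?thesis using that by simp
    qed
    thus ?thesis using 2 by (intro exI[of _ "[:1, 4:]"]) (auto simp: numeral_3_eq_3)
  next
    case 3
    obtain T1 where T1: "degree T1 \<le> Suc k" "\<And>r s :: real. r^2 = 1 + s^2 \<Longrightarrow>
      (r + s) ^ (2 * Suc k + 1) + (r - s) ^ (2 * Suc k + 1) = 2 * r * poly T1 (s^2)"
      using "1.IH"[rule_format, of "Suc k"] 3 by auto
    obtain T0 where T0: "degree T0 \<le> k" "\<And>r s :: real. r^2 = 1 + s^2 \<Longrightarrow>
      (r + s) ^ (2 * k + 1) + (r - s) ^ (2 * k + 1) = 2 * r * poly T0 (s^2)"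
      using "1.IH"[rule_format, of k] 3 by auto
    have "(r + s) ^ (2 * m + 1) + (r - s) ^ (2 * m + 1) = 2 * r * poly ([:2, 4:] * T1 - T0) (s^2)"
      if rs: "r^2 = 1 + s^2" for r s :: real
    proof -
      define A B where "A = r + s" and "B = r - s"
      have AB: "A * B = 1" "A^2 + B^2 = 2 + 4 * s^2"
        using rs by (auto simp: A_def B_def power2_eq_square algebra_simps)
      have "A ^ (2 * m + 1) + B ^ (2 * m + 1) =
        (A^2 + B^2) * (A ^ (2 * Suc k + 1) + B ^ (2 * Suc k + 1))
         - (A * B)^2 * (A ^ (2 * k + 1) + B ^ (2 * k + 1))"
        by (simp add: 3 power_add power_mult_distrib power2_eq_square algebra_simps)
      also have "\<dots> = (2 + 4 * s^2) * (2 * r * poly T1 (s^2)) - 2 * r * poly T0 (s^2)"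
        unfolding AB using T1(2)[OF rs] T0(2)[OF rs] by (simp add: A_def B_def)
      finally show ?thesis by (simp add: A_def B_def algebra_simps)
    qed
    moreover have "degree ([:2, 4:] * T1 - T0) \<le> m"
      using T1(1) T0(1) 3 degree_mult_le[of "[:2, 4:]" T1]
      by (intro degree_diff_le) auto
    ultimately show ?thesis by blast
  qed
qed

text \<open>As r + s and r - s are inverse to each other, changing the sign of the exponent only
  swaps the summands. Thus m and -m - 1 give the same sum, since -(2 m + 1) = 2 (-m - 1) +
  1.\<close>

lemma odd_powi_sum_poly:
  "\<exists>T. degree T \<le> nat (max m (- m - 1)) \<and> (\<forall>r s :: real. r^2 = 1 + s^2 \<longrightarrow>
     (r + s) powi (2 * m + 1) + (r - s) powi (2 * m + 1) = 2 * r * poly T (s^2))"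
proof (cases "m \<ge> 0")
  case True
  have "2 * m + 1 = int (2 * nat m + 1)" using True by simp
  thus ?thesis
    using odd_power_sum_poly[of "nat m"] True
    by (simp only: power_int_of_nat) (simp add: max_def)
next
  case False
  have e: "2 * m + 1 = - int (2 * nat (- m - 1) + 1)" using False by simp
  have inv: "inverse (r + s) = r - s" "inverse (r - s) = r + s" if "r^2 = 1 + s^2" for r s :: real
  proof -
    have "(r + s) * (r - s) = 1" "(r - s) * (r + s) = 1"
      using that by (auto simp: power2_eq_square algebra_simps)
    thus "inverse (r + s) = r - s" "inverse (r - s) = r + s"
      by (auto intro: inverse_unique)
  qed
  obtain T where T: "degree T \<le> nat (- m - 1)" "\<And>r s :: real. r^2 = 1 + s^2 \<Longrightarrow>
     (r + s) ^ (2 * nat (- m - 1) + 1) + (r - s) ^ (2 * nat (- m - 1) + 1) = 2 * r * poly T (s^2)"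
    using odd_power_sum_poly[of "nat (- m - 1)"] by blast
  have "(r + s) powi (2 * m + 1) + (r - s) powi (2 * m + 1) = 2 * r * poly T (s^2)"
    if rs: "r^2 = 1 + s^2" for r s :: real
    unfolding e power_int_minus power_int_of_nat power_inverse[symmetric] inv[OF rs]
    using T(2)[OF rs] by simp
  thus ?thesis using T(1) False by (intro exI[of _ T]) (auto simp: max_def)
qed

text \<open>Expanding p leaves fixed trigonometric moments, which multiply the coefficients of p and
  cannot raise the degree.\<close>

lemma trig_integral_poly:
  fixes p :: "real poly"
  shows "\<exists>Q. degree Q \<le> degree p \<and>
    (\<forall>\<eta>. integral {a..b} (\<lambda>t. cos t ^ k * poly p (\<eta> * sin t ^ 2)) = poly Q \<eta>)"
proof -
  define C where "C i = integral {a..b} (\<lambda>t. cos t ^ k * (sin t ^ 2) ^ i)" for i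
  define Q where "Q = (\<Sum>i\<le>degree p. monom (coeff p i * C i) i)"
  have "integral {a..b} (\<lambda>t. cos t ^ k * poly p (\<eta> * sin t ^ 2)) = poly Q \<eta>" for \<eta>
  proof -
    have "integral {a..b} (\<lambda>t. cos t ^ k * poly p (\<eta> * sin t ^ 2)) =
      integral {a..b} (\<lambda>t. \<Sum>i\<le>degree p. (coeff p i * \<eta> ^ i) * (cos t ^ k * (sin t ^ 2) ^ i))"
      by (simp add: poly_altdef sum_distrib_left power_mult_distrib mult_ac)
    also have "\<dots> = (\<Sum>i\<le>degree p. (coeff p i * \<eta> ^ i) * C i)"
      unfolding C_def
      by (subst integral_sum) (auto intro!: integrable_continuous_interval continuous_intros)
    also have "\<dots> = poly Q \<eta>"
      by (simp add: Q_def poly_sum poly_monom mult_ac)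
    finally show ?thesis .
  qed
  moreover have "degree Q \<le> degree p"
    unfolding Q_def by (intro degree_sum_le) (auto intro: order_trans[OF degree_monom_le])
  ultimately show ?thesis by blast
qed

section \<open>Parametrization of the conic\<close>

lemma conic_endpoints:
  fixes c :: real
  assumes "c > 1"
  shows "0 < c - sqrt (c^2 - 1)" "c - sqrt (c^2 - 1) < c + sqrt (c^2 - 1)"
    "(c - sqrt (c^2 - 1)) * (c + sqrt (c^2 - 1)) = 1"
proof -
  have "1 < c^2" using assms by (simp add: one_less_power)
  moreover have "sqrt (c^2 - 1) < sqrt (c^2)" by (intro real_sqrt_less_mono) simp
  ultimately show "0 < c - sqrt (c^2 - 1)" "c - sqrt (c^2 - 1) < c + sqrt (c^2 - 1)"
    "(c - sqrt (c^2 - 1)) * (c + sqrt (c^2 - 1)) = 1"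
    using assms by (auto simp: algebra_simps simp flip: power2_eq_square)
qed

lemma conic_pos_iff:
  fixes c u :: real
  assumes "c > 1"
  shows "2 * c * u - u^2 - 1 > 0 \<longleftrightarrow> u \<in> {c - sqrt (c^2 - 1)<..<c + sqrt (c^2 - 1)}"
proof -
  have "2 * c * u - u^2 - 1 > 0 \<longleftrightarrow> (u - c)^2 < c^2 - 1"
    by (auto simp: power2_eq_square algebra_simps)
  also have "\<dots> \<longleftrightarrow> sqrt ((u - c)^2) < sqrt (c^2 - 1)"
    by (simp only: real_sqrt_less_iff)
  also have "\<dots> \<longleftrightarrow> u \<in> {c - sqrt (c^2 - 1)<..<c + sqrt (c^2 - 1)}"
    by auto
  finally show ?thesis .
qed

text \<open>
  The conic is parametrized by \<open>u = (sqrt (1 + s\<^sup>2) + s)\<^sup>2\<close> with \<open>s = sqrt \<eta> sin t\<close>. Then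
  \<open>u + 1/u = 2 + 4 s\<^sup>2\<close>, and only the part of the integrand that is even in \<open>s\<close>, a polynomial
  in \<open>s\<^sup>2\<close>, contributes to the integral.
\<close>

lemma conic_integral_poly:
  assumes "odd j"
  shows "\<exists>p. degree p \<le> nat (max (l + int j) (- l - 2)) \<and>
    (\<forall>c>1. conic_integral l j c = (c - 1) / 2 * poly p ((c - 1) / 2))"
proof -
  obtain t where j: "j = 2 * t + 1" using assms by (elim oddE)
  \<comment> \<open>With A = r + s the factors u^l, v^j and du contribute A^(2 l), A^j and A^2. The
    total exponent 2 l + j + 2 is 2 m + 1.\<close>
  define m where "m = l + int t + 1"
  obtain T where T: "degree T \<le> nat (max m (- m - 1))" "\<And>r s :: real. r^2 = 1 + s^2 \<Longrightarrow>
     (r + s) powi (2 * m + 1) + (r - s) powi (2 * m + 1) = 2 * r * poly T (s^2)"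
    using odd_powi_sum_poly[of m] by blast
  obtain Q where Q: "degree Q \<le> degree T" "\<And>\<eta>. integral {-(pi/2)..pi/2}
     (\<lambda>x. cos x ^ (j + 1) * poly T (\<eta> * sin x ^ 2)) = poly Q \<eta>"
    using trig_integral_poly[of T "-(pi/2)" "pi/2" "j + 1"] by blast
  \<comment> \<open>The factors v^j and du carry \<open>sqrt \<eta>\<close> to the power j + 1, that
    is \<eta>^(t + 1). One \<eta> is split off in the claim and \<eta>^t is this monomial; it turns
    the degree max m (-m - 1) into max (l + j) (-l - 2).\<close>
  define p where "p = smult (2 ^ (j + 1)) (monom 1 t * Q)"
  have "degree p \<le> t + degree Q"
    unfolding p_def using degree_mult_le[of "monom 1 t" Q] degree_monom_le[of "1::real" t]
    by (intro order_trans[OF degree_smult_le]) linarith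
  also have "\<dots> \<le> t + nat (max m (- m - 1))" using Q(1) T(1) by simp
  also have "\<dots> = nat (max (l + int j) (- l - 2))" by (auto simp: m_def j max_def)
  finally have deg: "degree p \<le> nat (max (l + int j) (- l - 2))" .
  have "conic_integral l j c = (c - 1) / 2 * poly p ((c - 1) / 2)" if c: "c > 1" for c
  proof -
    define \<eta> where "\<eta> = (c - 1) / 2"
    have \<eta>: "\<eta> > 0" and c\<eta>: "c = 1 + 2 * \<eta>" using c by (auto simp: \<eta>_def field_simps)
    let ?a = "c - sqrt (c^2 - 1)" and ?b = "c + sqrt (c^2 - 1)"
    define s where "s x = sqrt \<eta> * sin x" for x
    define r where "r x = sqrt (1 + s x ^ 2)" for x
    define u where "u x = (r x + s x)^2" for x
    define f where "f u = u powi l * sqrt (2 * c * u - u^2 - 1) ^ j" for u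
    define G where "G x = 2 ^ (j + 1) * \<eta> ^ (t + 1) * (cos x ^ (j + 1) * ((r x + s x) powi (2 * m + 1) / r x))" for x
    have r2: "r x ^ 2 = 1 + s x ^ 2" for x by (simp add: r_def add_nonneg_nonneg)
    have r_pos: "r x > 0" for x by (simp add: r_def add_pos_nonneg)
    have A_pos: "r x + s x > 0" for x
    proof -
      have "sqrt (s x ^ 2) < r x" unfolding r_def by (intro real_sqrt_less_mono) simp
      thus ?thesis by simp
    qed
    have AB: "(r x + s x) * (r x - s x) = 1" for x
      using r2[of x] by (simp add: power2_eq_square algebra_simps)
    have s2: "s x ^ 2 = \<eta> - \<eta> * cos x ^ 2" for x
      using \<eta> by (simp add: s_def power_mult_distrib sin_squared_eq algebra_simps)
    \<comment> \<open>Writing 1 as the square of (r + s)(r - s) makes u a common factor. The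
      cofactor 2 c - (u + 1/u) equals 4 \<eta> cos^2 x, so the expression is a perfect
      square.\<close>
    have conic: "2 * c * u x - u x ^ 2 - 1 = (2 * sqrt \<eta> * (r x + s x) * cos x)^2" for x
    proof -
      have "2 * c * u x - u x ^ 2 - 1 = 2 * c * u x - u x ^ 2 - ((r x + s x) * (r x - s x))^2"
        by (simp add: AB)
      also have "\<dots> = u x * (2 * c - ((r x + s x)^2 + (r x - s x)^2))"
        by (simp add: u_def power2_eq_square algebra_simps)
      also have "(r x + s x)^2 + (r x - s x)^2 = 2 * (r x ^ 2) + 2 * s x ^ 2"
        by (simp add: power2_eq_square algebra_simps)
      also have "2 * c - (2 * (r x ^ 2) + 2 * s x ^ 2) = 4 * (\<eta> * cos x ^ 2)"
        unfolding r2 s2 by (simp add: c\<eta>)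
      also have "u x * (4 * (\<eta> * cos x ^ 2)) = (2 * sqrt \<eta> * (r x + s x) * cos x)^2"
        using \<eta> by (simp add: u_def power_mult_distrib)
      finally show ?thesis .
    qed
    have s_deriv: "(s has_real_derivative sqrt \<eta> * cos x) (at x within X)" for x X
      unfolding s_def by (auto intro!: derivative_eq_intros)
    have r_deriv: "(r has_real_derivative s x * (sqrt \<eta> * cos x) / r x) (at x within X)" for x X
    proof -
      have "((\<lambda>x. 1 + s x ^ 2) has_real_derivative 2 * s x * (sqrt \<eta> * cos x)) (at x within X)"
        by (rule derivative_eq_intros s_deriv refl | simp)+
      moreover have "(sqrt has_real_derivative inverse (r x) / 2) (at (1 + s x ^ 2))"
        unfolding r_def by (intro DERIV_real_sqrt) (simp add: add_pos_nonneg)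
      ultimately have "((\<lambda>x. sqrt (1 + s x ^ 2)) has_real_derivative
          inverse (r x) / 2 * (2 * s x * (sqrt \<eta> * cos x))) (at x within X)"
        by (rule DERIV_chain2[rotated])
      thus ?thesis by (simp add: r_def[abs_def] field_simps)
    qed
    have u_deriv: "(u has_real_derivative 2 * (r x + s x)^2 * (sqrt \<eta> * cos x) / r x) (at x within X)" for x X
      unfolding u_def[abs_def]
      by (rule derivative_eq_intros s_deriv r_deriv refl)+
        (use r_pos[of x] in \<open>simp add: field_simps power2_eq_square\<close>)
    have c_sq: "c^2 - 1 = (2 * sqrt (\<eta> * (1 + \<eta>)))^2"
      using \<eta> by (simp add: c\<eta> power2_eq_square algebra_simps)
    have sq: "sqrt (c^2 - 1) = 2 * sqrt \<eta> * sqrt (1 + \<eta>)"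
      unfolding c_sq using \<eta> by (simp add: real_sqrt_mult)
    have u_a: "u (-(pi/2)) = ?a"
      using \<eta> unfolding sq
      by (simp add: u_def r_def s_def power2_eq_square algebra_simps c\<eta>)
    have u_b: "u (pi/2) = ?b"
      using \<eta> unfolding sq
      by (simp add: u_def r_def s_def power2_eq_square algebra_simps c\<eta>)
    have u_ge: "u x \<in> {?a..?b}" for x
    proof -
      have "(u x - c)^2 \<le> c^2 - 1"
        using conic[of x] zero_le_power2[of "2 * sqrt \<eta> * (r x + s x) * cos x"]
        by (simp add: power2_diff algebra_simps)
      hence "sqrt ((u x - c)^2) \<le> sqrt (c^2 - 1)" by (rule real_sqrt_le_mono)
      thus ?thesis by auto
    qed
    have f_cont: "continuous_on {?a..?b} f"
      unfolding f_def using conic_endpoints[OF c] by (intro continuous_intros) auto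
    have "((\<lambda>x. (2 * (r x + s x)^2 * (sqrt \<eta> * cos x) / r x) *\<^sub>R f (u x)) has_integral
        integral {u (-(pi/2))..u (pi/2)} f) {-(pi/2)..pi/2}"
      using u_a u_b u_ge conic_endpoints[OF c] f_cont
      by (intro has_integral_substitution[where c = ?a and d = ?b] u_deriv) auto
    hence int0: "((\<lambda>x. (2 * (r x + s x)^2 * (sqrt \<eta> * cos x) / r x) *\<^sub>R f (u x)) has_integral
        conic_integral l j c) {-(pi/2)..pi/2}"
      by (simp only: u_a u_b conic_integral_def f_def[abs_def])
    have G_eq: "(2 * (r x + s x)^2 * (sqrt \<eta> * cos x) / r x) *\<^sub>R f (u x) = G x"
      if x: "x \<in> {-(pi/2)..pi/2}" for x
    proof -
      have "cos x \<ge> 0" using x by (intro cos_ge_zero) auto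
      hence "sqrt (2 * c * u x - u x ^ 2 - 1) = 2 * sqrt \<eta> * (r x + s x) * cos x"
        unfolding conic using \<eta> A_pos[of x] by simp
      hence "f (u x) = (r x + s x) powi (2 * l) * (2 * sqrt \<eta> * (r x + s x) * cos x) ^ j"
        by (simp add: f_def u_def power_int_mult)
      moreover have "(r x + s x) powi (2 * m + 1) = (r x + s x) powi (2 * l) * (r x + s x) ^ (j + 2)"
      proof -
        have "2 * m + 1 = 2 * l + int (j + 2)" by (simp add: m_def j)
        moreover have "r x + s x \<noteq> 0" using A_pos[of x] by simp
        ultimately show ?thesis by (simp only: power_int_add power_int_of_nat simp_thms)
      qed
      moreover have "sqrt \<eta> * sqrt \<eta> ^ j = \<eta> ^ (t + 1)"
      proof -
        have "sqrt \<eta> * sqrt \<eta> ^ j = (sqrt \<eta> ^ 2) ^ (t + 1)"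
          by (simp only: j power_mult[symmetric] power_Suc[symmetric]) simp
        also have "sqrt \<eta> ^ 2 = \<eta>" using \<eta> by simp
        finally show ?thesis .
      qed
      moreover have "(2 * A^2 * (S * C) / R) *\<^sub>R (P * (2 * S * A * C) ^ j) =
          2 ^ (j + 1) * (S * S ^ j) * (C ^ (j + 1) * (P * A ^ (j + 2) / R))" for A C R S P :: real
        by (simp add: power_mult_distrib power2_eq_square mult_ac)
      ultimately show ?thesis unfolding G_def by (simp only:)
    qed
    have int1: "(G has_integral conic_integral l j c) {-(pi/2)..pi/2}"
      by (rule has_integral_eq[OF G_eq int0])
    \<comment> \<open>The reflection x -> -x exchanges r + s and r - s. Adding both forms produces
      the symmetric sum 2 r T(s^2), whose factor r cancels the 1/r coming from du.\<close>
    hence int2: "((\<lambda>x. G (- x)) has_integral conic_integral l j c) {-(pi/2)..pi/2}"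
      using has_integral_reflect_lemma_real[OF int1] by simp
    have sym: "r (- x) = r x" "s (- x) = - s x" for x by (auto simp: r_def s_def)
    have "((\<lambda>x. G x + G (- x)) has_integral 2 * conic_integral l j c) {-(pi/2)..pi/2}"
      using has_integral_add[OF int1 int2] by simp
    moreover have "G x + G (- x) =
        2 * 2 ^ (j + 1) * \<eta> ^ (t + 1) * (cos x ^ (j + 1) * poly T (\<eta> * sin x ^ 2))" for x
    proof -
      have "(r x + s x) powi (2 * m + 1) / r x + (r x - s x) powi (2 * m + 1) / r x = 2 * poly T (s x ^ 2)"
        using T(2)[OF r2[of x]] r_pos[of x] by (simp add: field_simps)
      moreover have "s x ^ 2 = \<eta> * sin x ^ 2" using \<eta> by (simp add: s_def power_mult_distrib)
      moreover have "G x + G (- x) = 2 ^ (j + 1) * \<eta> ^ (t + 1) * (cos x ^ (j + 1) *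
          ((r x + s x) powi (2 * m + 1) / r x + (r x - s x) powi (2 * m + 1) / r x))"
        by (simp add: G_def sym distrib_left)
      ultimately show ?thesis by simp
    qed
    ultimately have "2 * conic_integral l j c = integral {-(pi/2)..pi/2} (\<lambda>x.
        2 * 2 ^ (j + 1) * \<eta> ^ (t + 1) * (cos x ^ (j + 1) * poly T (\<eta> * sin x ^ 2)))"
      by (simp add: has_integral_integrable_integral)
    also have "\<dots> = 2 * 2 ^ (j + 1) * \<eta> ^ (t + 1) * poly Q \<eta>"
      by (simp only: integral_mult_right Q(2))
    finally show ?thesis
      by (simp add: p_def poly_monom \<eta>_def[symmetric])
  qed
  with deg show ?thesis by blast
qed

text \<open>The derivative of u^(-3) v^3 is 3 u^(-4) v (1 - c u), and its integral is zero because v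
  vanishes at both ends. The relation links the only two integrals that occur for \<open>S2\<close>
  when n <= 1.\<close>

lemma conic_integral_ratio:
  assumes c: "c > 1"
  shows "conic_integral (- 4) 1 c = c * conic_integral (- 3) 1 c"
proof -
  let ?a = "c - sqrt (c^2 - 1)" and ?b = "c + sqrt (c^2 - 1)"
  define q where "q u = 2 * c * u - u^2 - 1" for u
  have pos: "u > 0" if "u \<in> {?a..?b}" for u using conic_endpoints[OF c] that by auto
  have int: "(\<lambda>u. u powi l * sqrt (q u)) integrable_on {?a..?b}" for l
    unfolding q_def using pos by (intro integrable_continuous_interval continuous_intros) fastforce
  have q0: "q ?a = 0" "q ?b = 0"
  proof -
    have "sqrt (c^2 - 1) ^ 2 = c^2 - 1" using c by (simp add: one_le_power)
    thus "q ?a = 0" "q ?b = 0" by (simp_all add: q_def power2_sum power2_diff) (simp_all add: power2_eq_square algebra_simps)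
  qed
  have "((\<lambda>u. 3 * (u powi (-4) * sqrt (q u) - c * (u powi (-3) * sqrt (q u)))) has_integral
     (?b powi (-3) * sqrt (q ?b) ^ 3 - ?a powi (-3) * sqrt (q ?a) ^ 3)) {?a..?b}"
  proof (rule fundamental_theorem_of_calculus_interior)
    show "continuous_on {?a..?b} (\<lambda>u. u powi (-3) * sqrt (q u) ^ 3)"
      unfolding q_def using pos by (intro continuous_intros) fastforce
    fix u assume u: "u \<in> {?a<..<?b}"
    have q: "q u > 0" using conic_pos_iff[OF c] u by (simp add: q_def)
    have u0: "u > 0" using pos u by auto
    have q_deriv: "(q has_real_derivative 2 * c - 2 * u) (at u)"
      unfolding q_def by (auto intro!: derivative_eq_intros)
    have sq: "sqrt (q u) ^ 2 = q u" using q by simp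
    have deriv: "((\<lambda>u. u powi (-3) * sqrt (q u) ^ 3) has_real_derivative
      (-3) * u powi (-4) * sqrt (q u) ^ 3 + u powi (-3) * (3 * sqrt (q u) ^ 2 * ((2 * c - 2 * u) * (inverse (sqrt (q u)) / 2)))) (at u)"
      using u0 q by (auto intro!: derivative_eq_intros q_deriv)
    have u3: "u powi (-3) = u * u powi (-4)" using u0 power_int_add_1'[of u "-4"] by simp
    have "z ^ 2 * inverse z = z" for z :: real by (cases "z = 0") (simp_all add: power2_eq_square)
    hence "sqrt (q u) ^ 2 * inverse (sqrt (q u)) = sqrt (q u)" .
    moreover have "u powi (-3) * (3 * sqrt (q u) ^ 2 * ((2 * c - 2 * u) * (inverse (sqrt (q u)) / 2)))
       = 3 * u powi (-4) * (u * (c - u)) * (sqrt (q u) ^ 2 * inverse (sqrt (q u)))"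
    proof -
      have "u * B * (3 * z * ((2 * c - 2 * u) * (w / 2))) = 3 * B * (u * (c - u)) * (z * w)" for B z w
        by (simp add: field_simps)
      thus ?thesis unfolding u3 .
    qed
    ultimately have "u powi (-3) * (3 * sqrt (q u) ^ 2 * ((2 * c - 2 * u) * (inverse (sqrt (q u)) / 2)))
       = 3 * (u powi (-4) * sqrt (q u)) * (u * (c - u))" by (simp only: mult_ac)
    moreover have "(-3) * u powi (-4) * sqrt (q u) ^ 3 = 3 * (u powi (-4) * sqrt (q u)) * (- q u)"
      using sq by (simp add: power3_eq_cube power2_eq_square)
    moreover have "3 * (u powi (-4) * sqrt (q u)) * (- q u) + 3 * (u powi (-4) * sqrt (q u)) * (u * (c - u))
      = 3 * (u powi (-4) * sqrt (q u) - c * (u powi (-3) * sqrt (q u)))"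
    proof -
      have "- q u + u * (c - u) = 1 - c * u" by (simp add: q_def power2_eq_square algebra_simps)
      moreover have "3 * B * (- q u) + 3 * B * (u * (c - u)) = 3 * B * (- q u + u * (c - u))" for B
        by (simp only: distrib_left)
      ultimately have "3 * B * (- q u) + 3 * B * (u * (c - u)) = 3 * B * (1 - c * u)" for B by simp
      moreover have "3 * (P * Z) * (1 - c * u) = 3 * (P * Z - c * (u * P * Z))" for P Z :: real
        by (simp add: algebra_simps)
      ultimately show ?thesis unfolding u3 by (simp only:)
    qed
    ultimately have "(-3) * u powi (-4) * sqrt (q u) ^ 3 + u powi (-3) * (3 * sqrt (q u) ^ 2 * ((2 * c - 2 * u) * (inverse (sqrt (q u)) / 2)))
      = 3 * (u powi (-4) * sqrt (q u) - c * (u powi (-3) * sqrt (q u)))" by (simp only:)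
    with deriv show "((\<lambda>u. u powi (-3) * sqrt (q u) ^ 3) has_vector_derivative
      3 * (u powi (-4) * sqrt (q u) - c * (u powi (-3) * sqrt (q u)))) (at u)"
      by (simp only: has_real_derivative_iff_has_vector_derivative)
  qed (use conic_endpoints[OF c] in auto)
  hence "integral {?a..?b} (\<lambda>u. 3 * (u powi (-4) * sqrt (q u) - c * (u powi (-3) * sqrt (q u)))) = 0"
    by (simp only: q0 has_integral_integrable_integral) simp
  also have "integral {?a..?b} (\<lambda>u. 3 * (u powi (-4) * sqrt (q u) - c * (u powi (-3) * sqrt (q u)))) =
     3 * (integral {?a..?b} (\<lambda>u. u powi (-4) * sqrt (q u)) - c * integral {?a..?b} (\<lambda>u. u powi (-3) * sqrt (q u)))"
    by (simp only: integral_mult_right integral_diff[OF int integrable_on_mult_right[OF int]])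
  finally have "integral {?a..?b} (\<lambda>u. u powi (-4) * sqrt (q u)) = c * integral {?a..?b} (\<lambda>u. u powi (-3) * sqrt (q u))"
    by simp
  thus ?thesis by (simp add: conic_integral_def q_def)
qed

section \<open>Reduction of the four systems to the conic\<close>

text \<open>This is the common form of the four reductions: x = \<open>X u\<close> is increasing in
  u, the ordinates are related by y = \<kappa> v, and the integrand becomes C u^l v^j. The expansion
  of the Abelian integral is a second conclusion because its conditions on the oval follow from the
  same data.\<close>

lemma oval_substitution:
  fixes X X' \<kappa> :: "real \<Rightarrow> real" and C :: "nat \<Rightarrow> nat \<Rightarrow> real" and l :: "nat \<Rightarrow> nat \<Rightarrow> int"
    and f g :: "nat \<Rightarrow> nat \<Rightarrow> real" and n :: nat
  defines "a \<equiv> \<lambda>c. c - sqrt (c^2 - 1)" and "b \<equiv> \<lambda>c. c + sqrt (c^2 - 1)"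
  assumes c: "c > 1"
    and X_deriv: "\<And>u. u \<in> {a c..b c} \<Longrightarrow> (X has_real_derivative X' u) (at u)"
    and X'_pos: "\<And>u. u \<in> {a c..b c} \<Longrightarrow> X' u > 0"
    and X_dom: "\<And>u. u \<in> {a c..b c} \<Longrightarrow> X u \<in> xdom s"
    and \<kappa>: "\<And>u. u \<in> {a c..b c} \<Longrightarrow> \<kappa> u > 0"
    and W: "\<And>u. u \<in> {a c..b c} \<Longrightarrow> Wfun s h (X u) = \<kappa> u ^ 2 * (2 * c * u - u^2 - 1)"
    and oval: "oval s h = {X (a c)<..<X (b c)}"
    and \<tau>: "\<tau> = 1 \<or> \<tau> = - 1" "\<And>x. x \<in> {X (a c)<..<X (b c)} \<Longrightarrow> \<tau> * (speed s * x) > 0"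
    and C: "\<And>i j u. u \<in> {a c..b c} \<Longrightarrow>
      X' u * (rpow (X u) (- kexp s - 2) * X u ^ i * \<kappa> u ^ j) = C i j * u powi l i j"
  shows "oval_integral s i j h = C i j * conic_integral (l i j) j c"
    and "abelian_integral s (poly2 n f) (poly2 n g) (poly2 n f) (poly2 n g) h
   = (\<Sum>(i, j) | i + j \<le> n. \<tau> * (1 - (- 1) ^ j) * g i j * oval_integral s (i + 1) j h
       + \<tau> * (1 + (- 1) ^ j) * ((real i - kexp s - 1) / real (j + 1)) * f i j * oval_integral s i (j + 1) h)"
proof -
  define q where "q u = 2 * c * u - u^2 - 1" for u
  have ab: "a c < b c" using conic_endpoints[OF c] by (simp add: a_def b_def)
  have X_cont: "continuous_on {a c..b c} X"
    by (rule DERIV_continuous_on[OF has_field_derivative_at_within[OF X_deriv]])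
  have mono: "X u < X v" if "a c \<le> u" "u < v" "v \<le> b c" for u v
  proof (rule DERIV_pos_imp_increasing[OF that(2)])
    fix t assume "u \<le> t" "t \<le> v"
    hence "t \<in> {a c..b c}" using that by simp
    thus "\<exists>d. (X has_real_derivative d) (at t) \<and> 0 < d" using X_deriv X'_pos by blast
  qed
  have lt: "X (a c) < X (b c)" using mono ab by simp
  have img: "X ` {a c..b c} \<subseteq> {X (a c)..X (b c)}"
  proof
    fix x assume "x \<in> X ` {a c..b c}"
    then obtain u where u: "u \<in> {a c..b c}" "x = X u" by (rule imageE)
    have "X (a c) \<le> X u" "X u \<le> X (b c)"
      using mono[of "a c" u] mono[of u "b c"] u(1) by (auto simp: order_le_less)
    thus "x \<in> {X (a c)..X (b c)}" using u(2) by simp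
  qed
  have surj: "{X (a c)..X (b c)} \<subseteq> X ` {a c..b c}"
  proof
    fix x assume "x \<in> {X (a c)..X (b c)}"
    thus "x \<in> X ` {a c..b c}" using IVT'[of X "a c" x "b c", OF _ _ _ X_cont] ab by auto
  qed
  have dom: "{X (a c)..X (b c)} \<subseteq> xdom s"
    using surj X_dom by blast
  have q0: "q (a c) = 0" "q (b c) = 0"
  proof -
    have "sqrt (c^2 - 1) ^ 2 = c^2 - 1" using c by (simp add: one_le_power)
    thus "q (a c) = 0" "q (b c) = 0"
      by (simp_all add: q_def a_def b_def power2_sum power2_diff) (simp_all add: power2_eq_square algebra_simps)
  qed
  have W0: "Wfun s h (X (a c)) = 0" "Wfun s h (X (b c)) = 0"
    using W[of "a c"] W[of "b c"] ab q0 by (auto simp: q_def)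
  show "abelian_integral s (poly2 n f) (poly2 n g) (poly2 n f) (poly2 n g) h
   = (\<Sum>(i, j) | i + j \<le> n. \<tau> * (1 - (- 1) ^ j) * g i j * oval_integral s (i + 1) j h
       + \<tau> * (1 + (- 1) ^ j) * ((real i - kexp s - 1) / real (j + 1)) * f i j * oval_integral s i (j + 1) h)"
    by (rule abelian_integral_eq[OF lt dom oval W0 \<tau>])
  define F where "F x = rpow x (- kexp s - 2) * x ^ i * sqrt (Wfun s h x) ^ j" for x
  have doms: "rpow_dom (- kexp s - 2) = xdom s"
    using rpow_dom_diff_1[of "- kexp s"] rpow_dom_diff_1[of "- kexp s - 1"]
    unfolding diff_diff_eq one_add_one
    by (simp_all add: xdom_eq_rpow_dom rpow_dom_uminus)
  have "continuous_on {X (a c)..X (b c)} (\<lambda>x. rpow x (- kexp s - 2))"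
    by (rule DERIV_continuous_on[OF has_field_derivative_at_within[OF rpow_has_real_derivative]])
      (use dom doms in blast)
  moreover have "continuous_on {X (a c)..X (b c)} (Wfun s h)"
    by (rule DERIV_continuous_on[OF has_field_derivative_at_within[OF Wfun_has_real_derivative]])
      (use dom in blast)
  ultimately have F_cont: "continuous_on {X (a c)..X (b c)} F"
    unfolding F_def[abs_def] by (intro continuous_intros)
  have "oval_integral s i j h = integral {X (a c)..X (b c)} F"
    by (simp add: oval_integral_def oval integral_open_interval_real F_def[abs_def])
  also have "\<dots> = integral {a c..b c} (\<lambda>u. X' u *\<^sub>R F (X u))"
    by (rule integral_unique[symmetric], rule has_integral_substitution[OF _ _ img F_cont
          has_field_derivative_at_within[OF X_deriv]]) (use ab lt in simp_all)
  also have "\<dots> = integral {a c..b c} (\<lambda>u. C i j * (u powi l i j * sqrt (q u) ^ j))"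
  proof (rule integral_cong)
    fix u assume u: "u \<in> {a c..b c}"
    have "sqrt (Wfun s h (X u)) = \<kappa> u * sqrt (q u)"
      using \<kappa>[OF u] by (simp add: W[OF u] q_def real_sqrt_mult)
    hence "X' u *\<^sub>R F (X u) = X' u * (rpow (X u) (- kexp s - 2) * X u ^ i * \<kappa> u ^ j) * sqrt (q u) ^ j"
      by (simp add: F_def power_mult_distrib)
    thus "X' u *\<^sub>R F (X u) = C i j * (u powi l i j * sqrt (q u) ^ j)"
      using C[OF u] by simp
  qed
  also have "\<dots> = C i j * conic_integral (l i j) j c"
    unfolding conic_integral_def a_def b_def q_def by (rule integral_mult_right)
  finally show "oval_integral s i j h = C i j * conic_integral (l i j) j c" .
qed

section \<open>Integer and half-integer exponents\<close>

lemma rpow_of_int: "r = of_int m \<Longrightarrow> rpow x r = x powi m"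
  by (simp add: rpow_def)

lemma half_not_Ints: "odd m \<Longrightarrow> r = of_int m / 2 \<Longrightarrow> r \<notin> \<int>" for r :: real
proof
  assume m: "odd m" "r = of_int m / 2" "r \<in> \<int>"
  then obtain k where "r = of_int k" by (elim Ints_cases)
  hence "real_of_int m = of_int (2 * k)" using m(2) by simp
  hence "m = 2 * k" by (simp only: of_int_eq_iff)
  thus False using m(1) by simp
qed

lemma rpow_square_half:
  assumes "odd m" "r = of_int m / 2" "u > 0"
  shows "rpow (u^2) r = u powi m"
proof -
  have "u^2 = u powr 2" using assms(3) by simp
  hence "rpow (u^2) r = (u powr 2) powr r"
    using half_not_Ints[OF assms(1,2)] by (simp only: rpow_def if_False)
  also have "\<dots> = u powi m"
    using powr_real_of_int'[of u m] assms by (simp only: powr_powr) simp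
  finally show ?thesis .
qed

lemma xdom_simps: "xdom S1 = {x. x \<noteq> 0}" "xdom S2 = {x. x \<noteq> 0}" "xdom R19 = {x. x > 0}" "xdom R20 = {x. x > 0}"
proof -
  have "(3 / 2 :: real) \<notin> \<int>" "(1 / 2 :: real) \<notin> \<int>"
    using half_not_Ints[of 3 "3/2"] half_not_Ints[of 1 "1/2"] by auto
  thus "xdom S1 = {x. x \<noteq> 0}" "xdom S2 = {x. x \<noteq> 0}" "xdom R19 = {x. x > 0}" "xdom R20 = {x. x > 0}"
    by (simp_all add: xdom_def)
qed

text \<open>This names the conclusion of \<open>abelian_integral_eq\<close> at a single h. The sign
  \<tau> is a parameter because the two families of ovals of \<open>S1\<close> have opposite
  signs.\<close>

definition abelian_expansion :: "system \<Rightarrow> real \<Rightarrow> nat \<Rightarrow> (nat \<Rightarrow> nat \<Rightarrow> real) \<Rightarrow> (nat \<Rightarrow> nat \<Rightarrow> real) \<Rightarrow> real \<Rightarrow> bool" where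
  "abelian_expansion s \<tau> n f g h \<longleftrightarrow> abelian_integral s (poly2 n f) (poly2 n g) (poly2 n f) (poly2 n g) h
   = (\<Sum>(i, j) | i + j \<le> n. \<tau> * (1 - (- 1) ^ j) * g i j * oval_integral s (i + 1) j h
       + \<tau> * (1 + (- 1) ^ j) * ((real i - kexp s - 1) / real (j + 1)) * f i j * oval_integral s i (j + 1) h)"

text \<open>Here y^2 = (2 c x - x^2 - 1)/2 with c = 1 + 2 h, so x itself is the variable u. The
  weight x^(-3) causes the shift of the exponent.\<close>

lemma S1_right:
  assumes h: "h > 0"
  shows "oval_integral S1 i j h = (1 / sqrt 2) ^ j * conic_integral (int i - 3) j (1 + 2 * h)"
    and "abelian_expansion S1 1 n f g h"
proof -
  let ?c = "1 + 2 * h"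
  have c: "?c > 1" using h by simp
  note ends = conic_endpoints[OF c]
  have W: "Wfun S1 h x = 1 / 2 * (2 * ?c * x - x^2 - 1)" for x
    by (simp add: Wfun_def rpow_of_int[of 1 1] algebra_simps)
  have oval: "oval S1 h = {?c - sqrt (?c^2 - 1)<..<?c + sqrt (?c^2 - 1)}"
  proof (intro set_eqI)
    fix x
    have "x \<in> oval S1 h \<longleftrightarrow> x \<noteq> 0 \<and> 2 * ?c * x - x^2 - 1 > 0"
      by (simp add: oval_def xdom_simps W)
    also have "\<dots> \<longleftrightarrow> x \<in> {?c - sqrt (?c^2 - 1)<..<?c + sqrt (?c^2 - 1)}"
      unfolding conic_pos_iff[OF c] using ends by auto
    finally show "x \<in> oval S1 h \<longleftrightarrow> x \<in> {?c - sqrt (?c^2 - 1)<..<?c + sqrt (?c^2 - 1)}" .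
  qed
  have ps: "u > 0" if "u \<in> {?c - sqrt (?c^2 - 1)..?c + sqrt (?c^2 - 1)}" for u
    using that ends by auto
  have C: "1 * (rpow u (- kexp S1 - 2) * u ^ i * (1 / sqrt 2) ^ j) = (1 / sqrt 2) ^ j * u powi (int i - 3)"
    if "u > 0" for u i j
    using that rpow_of_int[of "- kexp S1 - 2" "- 3" u] by (simp add: power_int_diff power_int_minus field_simps)
  have sp: "1 * (speed S1 * x) > 0" if "x \<in> {?c - sqrt (?c^2 - 1)<..<?c + sqrt (?c^2 - 1)}" for x
    using ps[of x] that by simp
  have side: "u \<in> xdom S1" if "u > 0" for u using that by (simp add: xdom_simps)
  have WX: "Wfun S1 h u = (1 / sqrt 2)^2 * (2 * ?c * u - u^2 - 1)" for u
    by (simp add: W power_divide)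
  note * = oval_substitution[where X = "\<lambda>u. u" and X' = "\<lambda>_. 1" and \<kappa> = "\<lambda>_. 1 / sqrt 2" and s = S1
      and h = h and \<tau> = 1 and C = "\<lambda>i j. (1 / sqrt 2) ^ j" and l = "\<lambda>i j. int i - 3", OF c]
  show "oval_integral S1 i j h = (1 / sqrt 2) ^ j * conic_integral (int i - 3) j ?c"
    by (rule *(1)[OF DERIV_ident _ side[OF ps] _ WX oval _ sp C[OF ps]]) simp_all
  show "abelian_expansion S1 1 n f g h" unfolding abelian_expansion_def
    by (rule *(2)[OF DERIV_ident _ side[OF ps] _ WX oval _ sp C[OF ps]]) simp_all
qed

text \<open>In -x the oval is the same conic with c = -1 - 2 h. Choosing x = -1/u instead of x = -u
  keeps the substitution increasing, as \<open>oval_substitution\<close> asks; it works because the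
  zeros of 2 c u - u^2 - 1 are reciprocal. Since x < 0, the sign \<tau> is -1.\<close>

lemma S1_left:
  assumes h: "h < - 1"
  shows "oval_integral S1 i j h =
      - ((- 1) ^ i * (1 / sqrt 2) ^ j) * conic_integral (1 - int i - int j) j (- 1 - 2 * h)"
    and "abelian_expansion S1 (- 1) n f g h"
proof -
  let ?c = "- 1 - 2 * h"
  have c: "?c > 1" using h by simp
  note ends = conic_endpoints[OF c]
  have W: "Wfun S1 h x = 1 / 2 * (2 * ?c * (- x) - (- x)^2 - 1)" for x
    by (simp add: Wfun_def rpow_of_int[of 1 1] algebra_simps)
  have inv: "1 / (?c - sqrt (?c^2 - 1)) = ?c + sqrt (?c^2 - 1)" "1 / (?c + sqrt (?c^2 - 1)) = ?c - sqrt (?c^2 - 1)"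
    using ends by (auto simp: divide_eq_eq mult.commute)
  have oval: "oval S1 h = {- (?c + sqrt (?c^2 - 1))<..<- (?c - sqrt (?c^2 - 1))}"
  proof (intro set_eqI)
    fix x
    have "x \<in> oval S1 h \<longleftrightarrow> x \<noteq> 0 \<and> 2 * ?c * (- x) - (- x)^2 - 1 > 0"
      by (simp add: oval_def xdom_simps W)
    also have "\<dots> \<longleftrightarrow> x \<in> {- (?c + sqrt (?c^2 - 1))<..<- (?c - sqrt (?c^2 - 1))}"
      unfolding conic_pos_iff[OF c] using ends by auto
    finally show "x \<in> oval S1 h \<longleftrightarrow> x \<in> {- (?c + sqrt (?c^2 - 1))<..<- (?c - sqrt (?c^2 - 1))}" .
  qed
  define X where "X u = - (1 / u)" for u :: real
  have oval': "oval S1 h = {X (?c - sqrt (?c^2 - 1))<..<X (?c + sqrt (?c^2 - 1))}"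
    unfolding X_def inv by (rule oval)
  have neg: "x < 0" if "x \<in> {X (?c - sqrt (?c^2 - 1))<..<X (?c + sqrt (?c^2 - 1))}" for x
    using that ends unfolding X_def inv by auto
  have WX: "Wfun S1 h (X u) = (1 / (sqrt 2 * u))^2 * (2 * ?c * u - u^2 - 1)" if "u > 0" for u
    using that by (simp add: W X_def field_simps power2_eq_square)
  have C: "1 / u^2 * (rpow (X u) (- kexp S1 - 2) * X u ^ i * (1 / (sqrt 2 * u)) ^ j) =
      - ((- 1) ^ i * (1 / sqrt 2) ^ j) * u powi (1 - int i - int j)" if u: "u > 0" for u i j
  proof -
    have "rpow (X u) (- kexp S1 - 2) = - (u ^ 3)"
      using rpow_of_int[of "- kexp S1 - 2" "- 3" "X u"] u
      by (simp add: X_def power_int_minus field_simps power3_eq_cube)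
    moreover have "X u ^ i = (- 1) ^ i / u ^ i" by (simp add: X_def power_minus[of "1/u"] power_divide)
    moreover have "u powi (1 - int i - int j) = u / u ^ i / u ^ j"
      using u by (simp add: power_int_diff)
    moreover have "(1 / (sqrt 2 * u)) ^ j = (1 / sqrt 2) ^ j / u ^ j"
      by (simp add: power_divide power_mult_distrib)
    moreover have "1 / u^2 * (- (u ^ 3) * (e / A) * (d / B)) = - (e * d) * (u / A / B)" for e d A B
      using u by (simp add: power2_eq_square power3_eq_cube)
    ultimately show ?thesis by (simp only:)
  qed
  have X_deriv: "(X has_real_derivative 1 / u^2) (at u)" if "u > 0" for u
    unfolding X_def[abs_def] using that by (auto intro!: derivative_eq_intros simp: power2_eq_square)
  have X'_pos: "1 / u^2 > 0" if "u > 0" for u :: real using that by simp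
  have X_neg: "X u < 0" if "u > 0" for u using that by (simp add: X_def)
  note * = oval_substitution[where X = X and X' = "\<lambda>u. 1 / u^2" and \<kappa> = "\<lambda>u. 1 / (sqrt 2 * u)" and s = S1
      and h = h and \<tau> = "- 1" and C = "\<lambda>i j. - ((- 1) ^ i * (1 / sqrt 2) ^ j)" and l = "\<lambda>i j. 1 - int i - int j", OF c]
  have ps: "u > 0" if "u \<in> {?c - sqrt (?c^2 - 1)..?c + sqrt (?c^2 - 1)}" for u
    using that ends by auto
  have side: "X u \<in> xdom S1" if "u > 0" for u using X_neg[OF that] by (simp add: xdom_simps)
  have sp: "- 1 * (speed S1 * x) > 0" if "x \<in> {X (?c - sqrt (?c^2 - 1))<..<X (?c + sqrt (?c^2 - 1))}" for x
    using neg[OF that] by (simp add: mult_pos_neg)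
  show "oval_integral S1 i j h =
      - ((- 1) ^ i * (1 / sqrt 2) ^ j) * conic_integral (1 - int i - int j) j ?c"
    by (rule *(1)[OF X_deriv[OF ps] X'_pos[OF ps] side[OF ps] _ WX[OF ps] oval' _ sp C[OF ps]]) (use ps in simp_all)
  show "abelian_expansion S1 (- 1) n f g h" unfolding abelian_expansion_def
    by (rule *(2)[OF X_deriv[OF ps] X'_pos[OF ps] side[OF ps] _ WX[OF ps] oval' _ sp C[OF ps]]) (use ps in simp_all)
qed

text \<open>From y^2 = 2 (2 x - (1 - h) x^2 - 1), the scaling x = u/w with w^2 = 1 - h normalizes
  the quadratic term and yields c = 1/w. As the scaling depends on h, a power of w remains in
  front.\<close>

lemma S2_oval:
  assumes h: "0 < h" "h < 1"
  defines "w \<equiv> sqrt (1 - h)"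
  shows "oval_integral S2 i j h = (sqrt 2 ^ j * w powi (3 - int i)) * conic_integral (int i - 4) j (1 / w)"
    and "abelian_expansion S2 1 n f g h"
proof -
  let ?c = "1 / w"
  have w: "0 < w" "w < 1" "w^2 = 1 - h" using h by (auto simp: w_def real_sqrt_less_iff)
  have c: "?c > 1" using w by simp
  note ends = conic_endpoints[OF c]
  have W: "Wfun S2 h x = 2 * (2 * ?c * (w * x) - (w * x)^2 - 1)" for x
  proof -
    have "(w * x)^2 = (1 - h) * x^2" by (simp add: power_mult_distrib w)
    moreover have "2 * ?c * (w * x) = 2 * x" using w by simp
    moreover have "Wfun S2 h x = 2 * (2 * x - (1 - h) * x^2 - 1)"
      by (simp add: Wfun_def rpow_of_int[of 2 2] algebra_simps)
    ultimately show ?thesis by simp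
  qed
  have oval: "oval S2 h = {(?c - sqrt (?c^2 - 1)) / w<..<(?c + sqrt (?c^2 - 1)) / w}"
  proof (intro set_eqI)
    fix x
    have "Wfun S2 h x > 0 \<longleftrightarrow> 2 * ?c * (w * x) - (w * x)^2 - 1 > 0"
    proof -
      have "0 < 2 * z \<longleftrightarrow> 0 < z" for z :: real by simp
      thus ?thesis unfolding W .
    qed
    hence "x \<in> oval S2 h \<longleftrightarrow> x \<noteq> 0 \<and> 2 * ?c * (w * x) - (w * x)^2 - 1 > 0"
      by (simp add: oval_def xdom_simps)
    also have "\<dots> \<longleftrightarrow> w * x \<in> {?c - sqrt (?c^2 - 1)<..<?c + sqrt (?c^2 - 1)}"
      unfolding conic_pos_iff[OF c] using ends by auto
    also have "\<dots> \<longleftrightarrow> x \<in> {(?c - sqrt (?c^2 - 1)) / w<..<(?c + sqrt (?c^2 - 1)) / w}"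
      using w by (simp add: pos_divide_less_eq pos_less_divide_eq mult.commute)
    finally show "x \<in> oval S2 h \<longleftrightarrow> x \<in> {(?c - sqrt (?c^2 - 1)) / w<..<(?c + sqrt (?c^2 - 1)) / w}" .
  qed
  have ps: "u > 0" if "u \<in> {?c - sqrt (?c^2 - 1)..?c + sqrt (?c^2 - 1)}" for u
    using that ends by auto
  have C: "1 / w * (rpow (u / w) (- kexp S2 - 2) * (u / w) ^ i * sqrt 2 ^ j) =
      (sqrt 2 ^ j * w powi (3 - int i)) * u powi (int i - 4)" if u: "u > 0" for u i j
  proof -
    have "rpow (u / w) (- kexp S2 - 2) = w ^ 4 / u ^ 4"
      using rpow_of_int[of "- kexp S2 - 2" "- 4" "u / w"] by (simp add: power_int_minus power_divide)
    moreover have "w powi (3 - int i) = w ^ 3 / w ^ i" "u powi (int i - 4) = u ^ i / u ^ 4"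
      using u w by (simp_all add: power_int_diff)
    moreover have "1 / w * (w ^ 4 / A * (B / D) * e) = (e * (w ^ 3 / D)) * (B / A)" for A B D e
      using w by (simp add: power3_eq_cube power4_eq_xxxx mult_ac)
    ultimately show ?thesis by (simp only: power_divide)
  qed
  have WX: "Wfun S2 h (u / w) = (sqrt 2)^2 * (2 * ?c * u - u^2 - 1)" for u
    using w unfolding W by simp
  have X_deriv: "((\<lambda>u. u / w) has_real_derivative 1 / w) (at u)" for u
    using w by (auto intro!: derivative_eq_intros)
  have side: "u / w \<in> xdom S2" if "u > 0" for u using that w by (simp add: xdom_simps)
  have sp: "1 * (speed S2 * x) > 0" if "x \<in> {(?c - sqrt (?c^2 - 1)) / w<..<(?c + sqrt (?c^2 - 1)) / w}" for x
  proof -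
    have "0 < (?c - sqrt (?c^2 - 1)) / w" using ends w by simp
    hence "x > 0" using that by (meson greaterThanLessThan_iff less_trans)
    thus ?thesis by simp
  qed
  note * = oval_substitution[where X = "\<lambda>u. u / w" and X' = "\<lambda>u. 1 / w" and \<kappa> = "\<lambda>u. sqrt 2" and s = S2
      and h = h and \<tau> = 1 and C = "\<lambda>i j. sqrt 2 ^ j * w powi (3 - int i)" and l = "\<lambda>i j. int i - 4", OF c]
  show "oval_integral S2 i j h = (sqrt 2 ^ j * w powi (3 - int i)) * conic_integral (int i - 4) j (1 / w)"
    by (rule *(1)[OF X_deriv _ side[OF ps] _ WX oval _ sp C[OF ps]]) (use w in simp_all)
  show "abelian_expansion S2 1 n f g h" unfolding abelian_expansion_def
    by (rule *(2)[OF X_deriv _ side[OF ps] _ WX oval _ sp C[OF ps]]) (use w in simp_all)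
qed

text \<open>With x = u^2 the half-integer powers become integer ones: y^2 is (2 c u - u^2 - 1)/64
  for \<open>R20\<close> and u^2 times this for \<open>R19\<close>, with c = 64 h in both cases. The
  additional factor u of \<kappa> in \<open>R19\<close> adds j to the exponent.\<close>

lemma R_oval:
  assumes s: "s \<in> {R19, R20}" and h: "h > 1 / 2^6"
  defines "\<kappa> \<equiv> \<lambda>u. if s = R19 then u / 8 else 1 / 8 :: real"
    and "l \<equiv> \<lambda>i j. if s = R19 then 2 * int i + int j - 6 else 2 * int i - 4"
  shows "oval_integral s i j h = (2 / 8 ^ j) * conic_integral (l i j) j (64 * h)"
    and "abelian_expansion s (- 1) n f g h"
proof -
  let ?c = "64 * h"
  have c: "?c > 1" using h by simp
  note ends = conic_endpoints[OF c]
  have W: "Wfun s h (u^2) = \<kappa> u ^ 2 * (2 * ?c * u - u^2 - 1)" if "u > 0" for u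
    using s rpow_square_half[of 3 "3/2" u] rpow_square_half[of 1 "1/2" u] that
    by (auto simp: Wfun_def \<kappa>_def field_simps power2_eq_square power3_eq_cube)
  have xd: "xdom s = {x. x > 0}" using s by (auto simp: xdom_simps)
  have \<kappa>: "\<kappa> u > 0" if "u > 0" for u using that by (simp add: \<kappa>_def)
  have ps: "u > 0" if "u \<in> {?c - sqrt (?c^2 - 1)..?c + sqrt (?c^2 - 1)}" for u
    using that ends by auto
  have oval: "oval s h = {(?c - sqrt (?c^2 - 1))^2<..<(?c + sqrt (?c^2 - 1))^2}"
  proof (intro set_eqI)
    fix x
    show "x \<in> oval s h \<longleftrightarrow> x \<in> {(?c - sqrt (?c^2 - 1))^2<..<(?c + sqrt (?c^2 - 1))^2}"
    proof (cases "x > 0")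
      case True
      define u where "u = sqrt x"
      have u: "u > 0" "x = u^2" using True by (auto simp: u_def)
      have "x \<in> oval s h \<longleftrightarrow> 2 * ?c * u - u^2 - 1 > 0"
        using \<kappa>[OF u(1)] u by (simp add: oval_def xd W zero_less_mult_iff)
      also have "\<dots> \<longleftrightarrow> u \<in> {?c - sqrt (?c^2 - 1)<..<?c + sqrt (?c^2 - 1)}"
        by (rule conic_pos_iff[OF c])
      also have "\<dots> \<longleftrightarrow> x \<in> {(?c - sqrt (?c^2 - 1))^2<..<(?c + sqrt (?c^2 - 1))^2}"
      proof -
        have "A^2 < B^2 \<longleftrightarrow> A < B" if "A > 0" "B > 0" for A B :: real
          using that by (simp flip: not_le)
        from this[of "?c - sqrt (?c^2 - 1)" u] this[of u "?c + sqrt (?c^2 - 1)"] show ?thesis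
          unfolding u(2) greaterThanLessThan_iff using ends u(1) by linarith
      qed
      finally show ?thesis .
    next
      case False
      hence "\<not> (?c - sqrt (?c^2 - 1))^2 < x" using zero_le_power2[of "?c - sqrt (?c^2 - 1)"] by linarith
      thus ?thesis using False by (simp add: oval_def xd)
    qed
  qed
  have C: "2 * u * (rpow (u^2) (- kexp s - 2) * (u^2) ^ i * \<kappa> u ^ j) = (2 / 8 ^ j) * u powi l i j"
    if u: "u > 0" for u i j
  proof -
    have "rpow (u^2) (- kexp s - 2) = u powi (if s = R19 then - 7 else - 5)"
      using s u rpow_square_half[of "- 7" "- 3/2 - 2" u] rpow_square_half[of "- 5" "- 1/2 - 2" u] by auto
    moreover have "u powi (2 * int i + int j - 6) = u * u powi (- 7) * (u^2) ^ i * u ^ j"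
    proof -
      have "2 * int i + int j - 6 = 1 + (- 7) + int (2 * i) + int j" by simp
      thus ?thesis using u
        by (simp only: power_int_add[OF disjI1[OF less_imp_neq[OF u, symmetric]]] power_int_of_nat power_mult power_int_1_right)
    qed
    moreover have "u powi (2 * int i - 4) = u * u powi (- 5) * (u^2) ^ i"
    proof -
      have "2 * int i - 4 = 1 + (- 5) + int (2 * i)" by simp
      thus ?thesis using u
        by (simp only: power_int_add[OF disjI1[OF less_imp_neq[OF u, symmetric]]] power_int_of_nat power_mult power_int_1_right)
    qed
    ultimately show ?thesis using s by (auto simp: \<kappa>_def l_def power_divide)
  qed
  have X_deriv: "((\<lambda>u. u^2) has_real_derivative 2 * u) (at u)" for u :: real
    by (auto intro!: derivative_eq_intros)
  have side: "u^2 \<in> xdom s" if "u > 0" for u using that by (simp add: xd)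
  have sp: "- 1 * (speed s * x) > 0" if "x \<in> {(?c - sqrt (?c^2 - 1))^2<..<(?c + sqrt (?c^2 - 1))^2}" for x
  proof -
    have "(?c - sqrt (?c^2 - 1))^2 < x" using that by simp
    hence "x > 0" by (rule le_less_trans[OF zero_le_power2])
    thus ?thesis using s by auto
  qed
  have pos': "2 * u > 0" if "u > 0" for u :: real using that by simp
  note * = oval_substitution[where X = "\<lambda>u. u^2" and X' = "\<lambda>u. 2 * u" and \<kappa> = \<kappa> and s = s
      and h = h and \<tau> = "- 1" and C = "\<lambda>i j. 2 / 8 ^ j" and l = l, OF c]
  show "oval_integral s i j h = (2 / 8 ^ j) * conic_integral (l i j) j ?c"
    by (rule *(1)[OF X_deriv pos'[OF ps] side[OF ps] \<kappa>[OF ps] W[OF ps] oval _ sp C[OF ps]]) simp_all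
  show "abelian_expansion s (- 1) n f g h" unfolding abelian_expansion_def
    by (rule *(2)[OF X_deriv pos'[OF ps] side[OF ps] \<kappa>[OF ps] W[OF ps] oval _ sp C[OF ps]]) simp_all
qed

section \<open>Counting zeros\<close>

text \<open>This serves the cases of small n in which M is a constant multiple of one oval integral:
  such an M has no zero unless the constant is 0.\<close>

lemma conic_integral_pos:
  assumes c: "c > 1"
  shows "conic_integral l j c > 0"
proof -
  let ?a = "c - sqrt (c^2 - 1)" and ?b = "c + sqrt (c^2 - 1)"
  have pos: "u > 0" if "u \<in> {?a..?b}" for u using conic_endpoints[OF c] that by auto
  have "integral {?a..?b} (\<lambda>_. 0) < integral {?a..?b} (\<lambda>u. u powi l * sqrt (2 * c * u - u^2 - 1) ^ j)"
  proof (rule integral_less_real)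
    show "continuous_on {?a..?b} (\<lambda>u. u powi l * sqrt (2 * c * u - u^2 - 1) ^ j)"
      using pos by (intro continuous_intros) fastforce
    fix u assume u: "u \<in> {?a<..<?b}"
    have "2 * c * u - u^2 - 1 > 0" using conic_pos_iff[OF c] u by blast
    moreover have "u > 0" using pos u by simp
    ultimately show "0 < u powi l * sqrt (2 * c * u - u^2 - 1) ^ j" by simp
  qed (use conic_endpoints[OF c] in auto)
  thus ?thesis by (simp add: conic_integral_def)
qed

text \<open>The coefficients in the expansion of M do not depend on h, so any class closed under
  linear combinations passes from the oval integrals to M. Each term raises one of its two indices
  by one, whence i + j <= n + 1. The class \<open>A\<close> is kept general because
  \<open>S2\<close> also records a root at 1.\<close>

lemma abelian_integral_in_class:
  fixes A :: "real poly set" and \<psi> G :: "real \<Rightarrow> real"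
  assumes A: "0 \<in> A" "\<And>p q. p \<in> A \<Longrightarrow> q \<in> A \<Longrightarrow> p + q \<in> A" "\<And>c p. p \<in> A \<Longrightarrow> smult c p \<in> A"
    and J: "\<And>i j. odd j \<Longrightarrow> i + j \<le> n + 1 \<Longrightarrow> \<exists>p\<in>A. \<forall>h\<in>S. oval_integral s i j h = poly p (\<psi> h) * G h"
    and M: "\<And>h. h \<in> S \<Longrightarrow> abelian_expansion s \<tau> n f g h"
  shows "\<exists>p\<in>A. \<forall>h\<in>S. abelian_integral s (poly2 n f) (poly2 n g) (poly2 n f) (poly2 n g) h = poly p (\<psi> h) * G h"
proof -
  define T where "T h p = \<tau> * (1 - (- 1) ^ snd p) * g (fst p) (snd p) * oval_integral s (fst p + 1) (snd p) h
       + \<tau> * (1 + (- 1) ^ snd p) * ((real (fst p) - kexp s - 1) / real (snd p + 1)) * f (fst p) (snd p) *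
         oval_integral s (fst p) (snd p + 1) h" for h p
  have terms: "\<exists>q\<in>A. \<forall>h\<in>S. T h p = poly q (\<psi> h) * G h" if p: "fst p + snd p \<le> n" for p
  proof (cases "odd (snd p)")
    case True
    then obtain q where q: "q \<in> A" "\<forall>h\<in>S. oval_integral s (fst p + 1) (snd p) h = poly q (\<psi> h) * G h"
      using J[of "snd p" "fst p + 1"] p by auto
    show ?thesis
      by (rule bexI[of _ "smult (\<tau> * 2 * g (fst p) (snd p)) q"]) (use True q(2) in \<open>simp add: T_def\<close>, rule A(3)[OF q(1)])
  next
    case False
    then obtain q where q: "q \<in> A" "\<forall>h\<in>S. oval_integral s (fst p) (snd p + 1) h = poly q (\<psi> h) * G h"
      using J[of "snd p + 1" "fst p"] p by auto
    show ?thesis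
      by (rule bexI[of _ "smult (\<tau> * 2 * ((real (fst p) - kexp s - 1) / real (snd p + 1)) * f (fst p) (snd p)) q"])
        (use False q(2) in \<open>simp add: T_def\<close>, rule A(3)[OF q(1)])
  qed
  have "\<exists>q\<in>A. \<forall>h\<in>S. (\<Sum>p\<in>I. T h p) = poly q (\<psi> h) * G h"
    if "finite I" "\<And>p. p \<in> I \<Longrightarrow> fst p + snd p \<le> n" for I
    using that
  proof (induction I rule: finite_induct)
    case empty
    thus ?case using A(1) by (intro bexI[of _ 0]) auto
  next
    case (insert p I)
    obtain q where q: "q \<in> A" "\<forall>h\<in>S. (\<Sum>p\<in>I. T h p) = poly q (\<psi> h) * G h"
      using insert by auto
    obtain r where r: "r \<in> A" "\<forall>h\<in>S. T h p = poly r (\<psi> h) * G h"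
      using terms insert.prems by blast
    show ?case
      by (rule bexI[of _ "r + q"]) (use insert.hyps q(2) r(2) in \<open>simp add: distrib_right\<close>, rule A(2)[OF r(1) q(1)])
  qed
  moreover have "finite {p. fst p + snd p \<le> n}"
    using finite_degree_le[of n] by (simp add: case_prod_unfold)
  ultimately obtain q where q: "q \<in> A" "\<forall>h\<in>S. (\<Sum>p | fst p + snd p \<le> n. T h p) = poly q (\<psi> h) * G h"
    by blast
  have "abelian_integral s (poly2 n f) (poly2 n g) (poly2 n f) (poly2 n g) h = poly q (\<psi> h) * G h" if "h \<in> S" for h
    using M[OF that] q(2) that by (simp add: abelian_expansion_def T_def case_prod_unfold)
  thus ?thesis using q(1) by blast
qed

lemma conic_integral_in_class:
  assumes "odd j" "nat (max (l + int j) (- l - 2)) \<le> d"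
    and "\<And>h. h \<in> S \<Longrightarrow> c h > 1" "\<And>h. h \<in> S \<Longrightarrow> J h = C * conic_integral l j (c h)"
    and "\<And>h. h \<in> S \<Longrightarrow> \<psi> h = (c h - 1) / 2"
  shows "\<exists>p\<in>{p. degree p \<le> d}. \<forall>h\<in>S. J h = poly p (\<psi> h) * \<psi> h powi 1"
proof -
  obtain p where p: "degree p \<le> nat (max (l + int j) (- l - 2))"
    "\<And>c. c > 1 \<Longrightarrow> conic_integral l j c = (c - 1) / 2 * poly p ((c - 1) / 2)"
    using conic_integral_poly[OF assms(1)] by blast
  have "degree (smult C p) \<le> d" using p(1) assms(2) degree_smult_le[of C p] by linarith
  moreover have "J h = poly (smult C p) (\<psi> h) * \<psi> h powi 1" if "h \<in> S" for h
    unfolding assms(4)[OF that] p(2)[OF assms(3)[OF that]] assms(5)[OF that, symmetric] by simp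
  ultimately show ?thesis by blast
qed

lemma degree_class_closed:
  "0 \<in> {p :: real poly. degree p \<le> d}"
  "p \<in> {p :: real poly. degree p \<le> d} \<Longrightarrow> q \<in> {p. degree p \<le> d} \<Longrightarrow> p + q \<in> {p. degree p \<le> d}"
  "p \<in> {p :: real poly. degree p \<le> d} \<Longrightarrow> smult c p \<in> {p. degree p \<le> d}"
  by (auto intro: degree_add_le order_trans[OF degree_smult_le])

text \<open>An affine \<psi> has constant derivative, hence e = 0. The exponent N = 1 accounts for
  the factor (c - 1)/2 split off in \<open>conic_integral_poly\<close>.\<close>

lemma isolated_zeros_affine:
  fixes \<psi> F :: "real \<Rightarrow> real"
  assumes "open S" "S \<subseteq> T" "\<alpha> \<noteq> 0" "\<And>h. \<psi> h = \<alpha> * h + \<beta>" "\<And>h. h \<in> S \<Longrightarrow> \<psi> h > 0"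
    and "\<exists>p\<in>{p. degree p \<le> d}. \<forall>h\<in>S. F h = poly p (\<psi> h) * \<psi> h powi 1"
  shows "finite (isolated_zeros F T \<inter> S) \<and>
    (\<Sum>h\<in>isolated_zeros F T \<inter> S. zero_multiplicity F h) \<le> enat d"
proof -
  obtain p where p: "degree p \<le> d" "\<forall>h\<in>S. F h = poly p (\<psi> h) * \<psi> h powi 1"
    using assms(6) by blast
  have \<psi>: "\<psi> = (\<lambda>h. \<alpha> * h + \<beta>)" using assms(4) by blast
  show ?thesis
  proof (rule isolated_zeros_poly_comp[OF assms(1-3), where \<psi> = \<psi> and e = 0 and N = 1 and p = p])
    show "(\<psi> has_real_derivative \<alpha> * \<psi> h powi 0) (at h)" for h
      unfolding \<psi> by (auto intro!: derivative_eq_intros)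
    show "inj_on \<psi> S" using assms(3) by (auto simp: inj_on_def \<psi>)
    show "(\<Sum>a | poly p a = 0 \<and> a \<in> \<psi> ` S. order a p) \<le> d \<or> p = 0"
      using sum_order_subset_le_degree[of p "{a. poly p a = 0 \<and> a \<in> \<psi> ` S}"] p(1) by fastforce
  qed (use assms(5) p(2) in auto)
qed

text \<open>Either c = 0 and F vanishes on an open set, or F has no zero in S.\<close>

lemma isolated_zeros_const_mult:
  fixes F G :: "real \<Rightarrow> real"
  assumes S: "open S" "S \<subseteq> T" and F: "\<And>h. h \<in> S \<Longrightarrow> F h = c * G h" and G: "\<And>h. h \<in> S \<Longrightarrow> G h \<noteq> 0"
  shows "isolated_zeros F T \<inter> S = {}"
proof (rule ccontr)
  assume "isolated_zeros F T \<inter> S \<noteq> {}"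
  then obtain h where h: "h \<in> S" "F h = 0" "\<forall>\<^sub>F t in at h within T. F t \<noteq> 0"
    by (auto simp: isolated_zeros_def)
  have c: "c = 0" using F[OF h(1)] G[OF h(1)] h(2) by simp
  have "at h within T = at h" using S h(1) by (meson at_within_open_subset)
  with h(3) have "\<forall>\<^sub>F t in at h. F t \<noteq> 0" by simp
  moreover have "\<forall>\<^sub>F t in at h. t \<in> S" using S(1) h(1) by (rule eventually_at_in_open')
  ultimately have "\<forall>\<^sub>F t in at h. False" by eventually_elim (simp add: F c)
  thus False by simp
qed

lemma num_isolated_zeros_le:
  assumes "finite (isolated_zeros F S \<inter> S) \<and> (\<Sum>h\<in>isolated_zeros F S \<inter> S. zero_multiplicity F h) \<le> enat d"
  shows "num_isolated_zeros F S \<le> enat d"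
proof -
  have "isolated_zeros F S \<inter> S = isolated_zeros F S" by (auto simp: isolated_zeros_def)
  thus ?thesis using assms by (simp add: num_isolated_zeros_def)
qed

section \<open>Bounds for the individual systems\<close>

lemma R_bound:
  fixes f g :: "nat \<Rightarrow> nat \<Rightarrow> real"
  defines "M s n \<equiv> abelian_integral s (poly2 n f) (poly2 n g) (poly2 n f) (poly2 n g)"
  shows "num_isolated_zeros (M R19 n) (Sig R19) \<le> enat (max (2 * n - 4) 3)"
    and "num_isolated_zeros (M R20 n) (Sig R20) \<le> enat (max (2 * n - 3) 2)"
proof -
  define S where "S = {1 / 2^6 :: real<..}"
  have *: "num_isolated_zeros (M s n) S \<le> enat d"
    if s: "s \<in> {R19, R20}" and d: "\<And>i j. odd j \<Longrightarrow> i + j \<le> n + 1 \<Longrightarrow>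
      nat (max (l i j + int j) (- l i j - 2)) \<le> d"
      and l: "\<And>i j. l i j = (if s = R19 then 2 * int i + int j - 6 else 2 * int i - 4)" for s d l
  proof -
    have "\<exists>p\<in>{p. degree p \<le> d}. \<forall>h\<in>S. M s n h = poly p ((64 * h - 1) / 2) * ((64 * h - 1) / 2) powi 1"
      unfolding M_def
    proof (rule abelian_integral_in_class[OF degree_class_closed])
      show "abelian_expansion s (- 1) n f g h" if "h \<in> S" for h
        using R_oval(2)[OF s, of h] that by (simp add: S_def)
      fix i j :: nat assume ij: "odd j" "i + j \<le> n + 1"
      show "\<exists>p\<in>{p. degree p \<le> d}. \<forall>h\<in>S. oval_integral s i j h = poly p ((64 * h - 1) / 2) * ((64 * h - 1) / 2) powi 1"
        by (rule conic_integral_in_class[OF ij(1) d[OF ij], where c = "\<lambda>h. 64 * h" and C = "2 / 8 ^ j"])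
          (use R_oval(1)[OF s, of _ i j] in \<open>simp_all add: S_def l\<close>)
    qed
    thus ?thesis
      by (intro num_isolated_zeros_le isolated_zeros_affine[where \<psi> = "\<lambda>h. (64 * h - 1) / 2" and \<alpha> = 32 and \<beta> = "- 1/2"])
        (auto simp: S_def field_simps)
  qed
  \<comment> \<open>The two numbers are l + j = 2 (i + j) - 6 <= 2 n - 4 and -l - 2 = 4 - 2 i - j <=
    3, the latter because j is odd and so at least 1.\<close>
  have "num_isolated_zeros (M R19 n) S \<le> enat (max (2 * n - 4) 3)"
    by (rule *[where l = "\<lambda>i j. 2 * int i + int j - 6"]) (auto simp: nat_le_iff elim!: oddE)
  thus "num_isolated_zeros (M R19 n) (Sig R19) \<le> enat (max (2 * n - 4) 3)" by (simp add: S_def)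
  \<comment> \<open>Here l + j = 2 i + j - 4 with i <= n and i + j <= n + 1, hence at most 2 n - 3,
    while -l - 2 = 2 - 2 i <= 2.\<close>
  have "num_isolated_zeros (M R20 n) S \<le> enat (max (2 * n - 3) 2)"
    by (rule *[where l = "\<lambda>i j. 2 * int i - 4"]) (auto simp: nat_le_iff elim!: oddE)
  thus "num_isolated_zeros (M R20 n) (Sig R20) \<le> enat (max (2 * n - 3) 2)" by (simp add: S_def)
qed

text \<open>Each component of \<Sigma> carries its own polynomial, in h or in -1 - h, and
  contributes at most n. The degree is at most max (n - 2) 1 on the right, and on the left as well
  with the roles of l + j and -l - 2 exchanged; this is at most n as soon as n >= 1.\<close>

lemma S1_bound:
  fixes f g :: "nat \<Rightarrow> nat \<Rightarrow> real"
  defines "M n \<equiv> abelian_integral S1 (poly2 n f) (poly2 n g) (poly2 n f) (poly2 n g)"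
  shows "num_isolated_zeros (M n) (Sig S1) \<le> enat (2 * n)"
proof -
  let ?Z = "isolated_zeros (M n) (Sig S1)"
  have split: "?Z = (?Z \<inter> {0<..}) \<union> (?Z \<inter> {..<- 1})" by (auto simp: isolated_zeros_def)
  have "finite (?Z \<inter> {0<..}) \<and> (\<Sum>h\<in>?Z \<inter> {0<..}. zero_multiplicity (M n) h) \<le> enat n \<and>
    finite (?Z \<inter> {..<- 1}) \<and> (\<Sum>h\<in>?Z \<inter> {..<- 1}. zero_multiplicity (M n) h) \<le> enat n"
  proof (cases "n = 0")
    \<comment> \<open>Only i = 0 and j = 1 occur. On each component M is a constant multiple of the
      same integral, which has constant sign there.\<close>
    case True
    have "\<exists>p\<in>{p. degree p \<le> 0}. \<forall>h\<in>{0<..}. M n h = poly p h * oval_integral S1 0 1 h"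
      unfolding M_def
    proof (rule abelian_integral_in_class[OF degree_class_closed, where \<tau> = 1 and \<psi> = "\<lambda>h. h"])
      fix i j :: nat assume "odd j" "i + j \<le> n + 1"
      hence "i = 0" "j = 1" using True by (auto elim!: oddE)
      thus "\<exists>p\<in>{p. degree p \<le> 0}. \<forall>h\<in>{0<..}. oval_integral S1 i j h = poly p h * oval_integral S1 0 1 h"
        by (intro bexI[of _ 1]) auto
    qed (use S1_right in auto)
    then obtain p where p: "degree p = 0" "\<forall>h\<in>{0<..}. M n h = poly p h * oval_integral S1 0 1 h" by auto
    obtain c where "p = [:c:]" using degree_eq_zeroE[OF p(1)] by blast
    hence c: "\<forall>h\<in>{0<..}. M n h = c * oval_integral S1 0 1 h" using p(2) by simp
    have 1: "?Z \<inter> {0<..} = {}"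
      by (rule isolated_zeros_const_mult[where G = "oval_integral S1 0 1" and c = c])
        (use c conic_integral_pos S1_right(1)[of _ 0 1] in \<open>auto simp: less_imp_neq[symmetric]\<close>)
    have "\<exists>p\<in>{p. degree p \<le> 0}. \<forall>h\<in>{..<- 1}. M n h = poly p h * oval_integral S1 0 1 h"
      unfolding M_def
    proof (rule abelian_integral_in_class[OF degree_class_closed, where \<tau> = "- 1" and \<psi> = "\<lambda>h. h"])
      fix i j :: nat assume "odd j" "i + j \<le> n + 1"
      hence "i = 0" "j = 1" using True by (auto elim!: oddE)
      thus "\<exists>p\<in>{p. degree p \<le> 0}. \<forall>h\<in>{..<- 1}. oval_integral S1 i j h = poly p h * oval_integral S1 0 1 h"
        by (intro bexI[of _ 1]) auto
    qed (use S1_left in auto)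
    then obtain p where p: "degree p = 0" "\<forall>h\<in>{..<- 1}. M n h = poly p h * oval_integral S1 0 1 h" by auto
    obtain c where "p = [:c:]" using degree_eq_zeroE[OF p(1)] by blast
    hence c: "\<forall>h\<in>{..<- 1}. M n h = c * oval_integral S1 0 1 h" using p(2) by simp
    have 2: "?Z \<inter> {..<- 1} = {}"
      by (rule isolated_zeros_const_mult[where G = "oval_integral S1 0 1" and c = c])
        (use c conic_integral_pos S1_left(1)[of _ 0 1] in \<open>auto simp: less_imp_neq[symmetric]\<close>)
    show ?thesis unfolding 1 2 by simp
  next
    case False
    have "\<exists>p\<in>{p. degree p \<le> n}. \<forall>h\<in>{0<..}. M n h = poly p h * h powi 1"
      unfolding M_def
    proof (rule abelian_integral_in_class[OF degree_class_closed, where \<tau> = 1 and \<psi> = "\<lambda>h. h" and G = "\<lambda>h. h powi 1"])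
      fix i j :: nat assume ij: "odd j" "i + j \<le> n + 1"
      show "\<exists>p\<in>{p. degree p \<le> n}. \<forall>h\<in>{0<..}. oval_integral S1 i j h = poly p h * h powi 1"
        by (rule conic_integral_in_class[OF ij(1), where c = "\<lambda>h. 1 + 2 * h" and C = "(1 / sqrt 2) ^ j" and l = "int i - 3"])
          (use S1_right(1)[of _ i j] ij False in \<open>simp_all\<close>)
    qed (use S1_right in auto)
    moreover have "\<exists>p\<in>{p. degree p \<le> n}. \<forall>h\<in>{..<- 1}. M n h = poly p (- 1 - h) * (- 1 - h) powi 1"
      unfolding M_def
    proof (rule abelian_integral_in_class[OF degree_class_closed, where \<tau> = "- 1" and \<psi> = "\<lambda>h. - 1 - h" and G = "\<lambda>h. (- 1 - h) powi 1"])
      fix i j :: nat assume ij: "odd j" "i + j \<le> n + 1"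
      show "\<exists>p\<in>{p. degree p \<le> n}. \<forall>h\<in>{..<- 1}. oval_integral S1 i j h = poly p (- 1 - h) * (- 1 - h) powi 1"
        by (rule conic_integral_in_class[OF ij(1), where c = "\<lambda>h. - 1 - 2 * h" and
             C = "- ((- 1) ^ i * (1 / sqrt 2) ^ j)" and l = "1 - int i - int j"])
          (use S1_left(1)[of _ i j] ij False in \<open>simp_all\<close>)
    qed (use S1_left in auto)
    ultimately show ?thesis
      using isolated_zeros_affine[of "{0<..}" "Sig S1" 1 "\<lambda>h. h" 0 n "M n"]
        isolated_zeros_affine[of "{..<- 1}" "Sig S1" "- 1" "\<lambda>h. - 1 - h" "- 1" n "M n"] by simp
  qed
  moreover have "(\<Sum>h\<in>?Z. zero_multiplicity (M n) h) =
    (\<Sum>h\<in>?Z \<inter> {0<..}. zero_multiplicity (M n) h) + (\<Sum>h\<in>?Z \<inter> {..<- 1}. zero_multiplicity (M n) h)"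
    if "finite (?Z \<inter> {0<..})" "finite (?Z \<inter> {..<- 1})"
    by (subst split, rule sum.union_disjoint) (use that in auto)
  moreover have "finite ?Z" if "finite (?Z \<inter> {0<..})" "finite (?Z \<inter> {..<- 1})"
    by (subst split) (use that in simp)
  ultimately have "finite ?Z \<and> (\<Sum>h\<in>?Z. zero_multiplicity (M n) h) \<le> enat n + enat n"
    by (simp del: plus_enat_simps add: add_mono)
  thus ?thesis by (simp add: num_isolated_zeros_def mult_2)
qed

text \<open>Since (1/w - 1)/2 = (1 - w)/(2 w), multiplication by w^d clears all denominators without
  exceeding degree d.\<close>

lemma poly_inverse_homogenize:
  fixes p :: "real poly"
  assumes "degree p \<le> d"
  shows "\<exists>q. degree q \<le> d \<and> (\<forall>w>0. poly p ((1 / w - 1) / 2) = poly q w * w powi (- int d))"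
proof -
  define q where "q = (\<Sum>k\<le>d. smult (coeff p k / 2 ^ k) ([:1, - 1:] ^ k * monom 1 (d - k)))"
  have "degree ([:1, - 1 :: real:] ^ k * monom 1 (d - k)) \<le> d" if "k \<le> d" for k
  proof -
    have "degree ([:1, - 1 :: real:] ^ k) \<le> k" using degree_power_le[of "[:1, - 1 :: real:]" k] by simp
    thus ?thesis
      using degree_mult_le[of "[:1, - 1 :: real:] ^ k" "monom 1 (d - k)"] degree_monom_le[of "1 :: real" "d - k"] that
      by linarith
  qed
  hence "degree q \<le> d" unfolding q_def
    by (intro degree_sum_le) (auto intro: order_trans[OF degree_smult_le])
  moreover have "poly p ((1 / w - 1) / 2) = poly q w * w powi (- int d)" if w: "w > 0" for w
  proof -
    have "poly p ((1 / w - 1) / 2) = poly (\<Sum>k\<le>d. monom (coeff p k) k) ((1 / w - 1) / 2)"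
      by (simp add: poly_as_sum_of_monoms'[OF assms])
    also have "\<dots> = (\<Sum>k\<le>d. coeff p k * ((1 / w - 1) / 2) ^ k)"
      by (simp add: poly_sum poly_monom)
    also have "\<dots> = (\<Sum>k\<le>d. coeff p k / 2 ^ k * ((1 - w) ^ k * w ^ (d - k)) * w powi (- int d))"
    proof (intro sum.cong refl)
      fix k assume "k \<in> {..d}"
      hence d: "w ^ d = w ^ k * w ^ (d - k)" by (simp flip: power_add)
      have "(1 / w - 1) / 2 = (1 - w) / (2 * w)" using w by (simp add: field_simps)
      thus "coeff p k * ((1 / w - 1) / 2) ^ k = coeff p k / 2 ^ k * ((1 - w) ^ k * w ^ (d - k)) * w powi (- int d)"
        using w by (simp add: power_int_minus d power_divide power_mult_distrib field_simps)
    qed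
    also have "\<dots> = poly q w * w powi (- int d)"
      by (simp add: q_def poly_sum poly_monom sum_distrib_right)
    finally show ?thesis .
  qed
  ultimately show ?thesis by blast
qed

text \<open>The variable is w in (0, 1). The factor (c - 1)/2 = (1 - w)/(2 w) forces a root at w =
  1, outside this range, so a polynomial of degree at most 2 n - 1 leaves 2 n - 2 zeros when n >=
  2.\<close>

lemma S2_bound:
  fixes f g :: "nat \<Rightarrow> nat \<Rightarrow> real"
  defines "M n \<equiv> abelian_integral S2 (poly2 n f) (poly2 n g) (poly2 n f) (poly2 n g)"
  shows "num_isolated_zeros (M n) (Sig S2) \<le> enat (2 * n - 2)"
proof (cases "n \<le> 1")
  case True
  have w: "0 < sqrt (1 - h)" "1 / sqrt (1 - h) > 1" if "h \<in> {0<..<1}" for h using that by auto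
  \<comment> \<open>The ratio c = 1/w of the two conic integrals is compensated by the prefactors
    w^3 and w^2, which makes the oval integrals equal.\<close>
  have J01: "oval_integral S2 0 1 h = oval_integral S2 1 1 h" if h: "h \<in> {0<..<1}" for h
  proof -
    have "oval_integral S2 0 1 h = sqrt 2 * sqrt (1 - h) ^ 3 * (1 / sqrt (1 - h) * conic_integral (- 3) 1 (1 / sqrt (1 - h)))"
      using S2_oval(1)[of h 0 1] h conic_integral_ratio[OF w(2)[OF h]] by simp
    also have "\<dots> = sqrt 2 * sqrt (1 - h) ^ 2 * conic_integral (- 3) 1 (1 / sqrt (1 - h))"
      using w(1)[OF h] by (simp add: power2_eq_square power3_eq_cube)
    also have "\<dots> = oval_integral S2 1 1 h"
      using S2_oval(1)[of h 1 1] h by simp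
    finally show ?thesis .
  qed
  have "\<exists>p\<in>{p. degree p \<le> 0}. \<forall>h\<in>{0<..<1}. M n h = poly p h * oval_integral S2 1 1 h"
    unfolding M_def
  proof (rule abelian_integral_in_class[OF degree_class_closed, where \<tau> = 1 and \<psi> = "\<lambda>h. h"])
    fix i j :: nat assume "odd j" "i + j \<le> n + 1"
    hence "(i = 0 \<or> i = 1) \<and> j = 1" using True by (auto elim!: oddE)
    thus "\<exists>p\<in>{p. degree p \<le> 0}. \<forall>h\<in>{0<..<1}. oval_integral S2 i j h = poly p h * oval_integral S2 1 1 h"
      using J01 by (intro bexI[of _ 1]) auto
  qed (use S2_oval in auto)
  then obtain p where p: "degree p = 0" "\<forall>h\<in>{0<..<1}. M n h = poly p h * oval_integral S2 1 1 h" by auto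
  obtain c where "p = [:c:]" using degree_eq_zeroE[OF p(1)] by blast
  hence c: "\<forall>h\<in>{0<..<1}. M n h = c * oval_integral S2 1 1 h" using p(2) by simp
  have "oval_integral S2 1 1 h \<noteq> 0" if h: "h \<in> {0<..<1}" for h
    using S2_oval(1)[of h 1 1] h w[OF h] conic_integral_pos[OF w(2)[OF h], of "- 3" 1] by simp
  hence "isolated_zeros (M n) (Sig S2) \<inter> {0<..<1} = {}"
    by (intro isolated_zeros_const_mult[where G = "oval_integral S2 1 1" and c = c]) (use c in auto)
  hence "num_isolated_zeros (M n) {0<..<1} \<le> enat 0"
    by (intro num_isolated_zeros_le) (simp add: zero_enat_def)
  also have "enat 0 \<le> enat (2 * n - 2)" by simp
  finally show ?thesis by simp
next
  case False
  define \<psi> where "\<psi> h = sqrt (1 - h)" for h :: real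
  \<comment> \<open>A power of w common to all oval integrals: with d the degree bound for the conic
    integral, 2 - i - d is at least 4 - 2 n once n >= 2.\<close>
  define N where "N = 4 - 2 * int n"
  let ?A = "{p :: real poly. degree p \<le> 2 * n - 1 \<and> poly p 1 = 0}"
  have \<psi>: "0 < \<psi> h" "\<psi> h < 1" "1 / \<psi> h > 1" if "h \<in> {0<..<1}" for h using that by (auto simp: \<psi>_def)
  have "\<exists>p\<in>?A. \<forall>h\<in>{0<..<1}. M n h = poly p (\<psi> h) * \<psi> h powi N"
    unfolding M_def
  proof (rule abelian_integral_in_class[where \<tau> = 1])
    fix i j :: nat assume ij: "odd j" "i + j \<le> n + 1"
    define d where "d = nat (max (int i - 4 + int j) (- (int i - 4) - 2))"
    obtain p where p: "degree p \<le> d"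
      "\<And>c. c > 1 \<Longrightarrow> conic_integral (int i - 4) j c = (c - 1) / 2 * poly p ((c - 1) / 2)"
      using conic_integral_poly[OF ij(1), of "int i - 4"] unfolding d_def by blast
    obtain q where q: "degree q \<le> d" "\<And>w. w > 0 \<Longrightarrow> poly p ((1 / w - 1) / 2) = poly q w * w powi (- int d)"
      using poly_inverse_homogenize[OF p(1)] by blast
    \<comment> \<open>The exponent of w left after extracting w^N, collected from w^(3 - i), the 1/w
      in (1 - w)/(2 w), and w^(-d). The resulting degree is at most e + 1 + d = 3 - i - N, which is
      2 n - 1 - i.\<close>
    define e where "e = nat (2 - int i - int d - N)"
    have "j \<ge> 1" using ij(1) by (auto elim!: oddE)
    moreover have "int d = max 0 (max (int i - 4 + int j) (2 - int i))" by (simp add: d_def)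
    ultimately have "0 \<le> 2 - int i - int d - N"
      using ij(2) False unfolding N_def by linarith
    hence e: "int e = 2 - int i - int d - N" by (simp add: e_def)
    hence e_le: "e + 1 + d \<le> 2 * n - 1" using False unfolding N_def by linarith
    define P where "P = smult (sqrt 2 ^ j / 2) (monom 1 e * ([:1, - 1:] * q))"
    have "degree P \<le> degree (monom (1::real) e) + (degree [:1, - 1 :: real:] + degree q)"
      unfolding P_def
      by (rule order_trans[OF degree_smult_le], rule order_trans[OF degree_mult_le], rule add_left_mono, rule degree_mult_le)
    also have "\<dots> \<le> e + (1 + d)" using q(1) degree_monom_le[of "1::real" e] by (intro add_mono) auto
    finally have "P \<in> ?A" using e_le by (simp add: P_def)
    moreover have "oval_integral S2 i j h = poly P (\<psi> h) * \<psi> h powi N" if h: "h \<in> {0<..<1}" for h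
    proof -
      define w where "w = \<psi> h"
      have w: "w > 0" "1 / w > 1" using \<psi>[OF h] by (auto simp: w_def)
      have pw: "w powi (3 - int i) * (1 / w - 1) * w powi (- int d) = w ^ e * (1 - w) * w powi N"
      proof -
        have "w powi (3 - int i) * w powi (- int d) = w powi (3 - int i - int d)"
          using w power_int_add[of w "3 - int i" "- int d"] by simp
        also have "3 - int i - int d = 1 + int e + N" using e by simp
        also have "w powi (1 + int e + N) = w * w ^ e * w powi N"
          using w by (simp add: power_int_add)
        finally have "w powi (3 - int i) * w powi (- int d) = w * w ^ e * w powi N" .
        moreover have "w powi (3 - int i) * (1 / w - 1) * w powi (- int d) =
            w powi (3 - int i) * w powi (- int d) * (1 / w - 1)"
          by (rule mult.commute[THEN trans]) (simp only: mult_ac)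
        moreover have "w * A * B * (1 / w - 1) = A * (1 - w) * B" for A B
          using w by (simp add: right_diff_distrib left_diff_distrib)
        ultimately show ?thesis by (simp only:)
      qed
      have "oval_integral S2 i j h = sqrt 2 ^ j * w powi (3 - int i) * ((1 / w - 1) / 2 * (poly q w * w powi (- int d)))"
        using S2_oval(1)[of h i j] h p(2)[OF w(2)] q(2)[OF w(1)]
        unfolding w_def \<psi>_def by (simp only: greaterThanLessThan_iff)
      also have "\<dots> = sqrt 2 ^ j / 2 * poly q w * (w powi (3 - int i) * (1 / w - 1) * w powi (- int d))"
        by simp
      also have "\<dots> = poly P w * w powi N"
        unfolding pw by (simp add: P_def poly_monom algebra_simps)
      finally show ?thesis by (simp add: w_def)
    qed
    ultimately show "\<exists>p\<in>?A. \<forall>h\<in>{0<..<1}. oval_integral S2 i j h = poly p (\<psi> h) * \<psi> h powi N" by blast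
  next
    show "p + q \<in> ?A" if "p \<in> ?A" "q \<in> ?A" for p q using that by (auto intro: degree_add_le)
    show "smult c p \<in> ?A" if "p \<in> ?A" for c p using that by (auto intro: order_trans[OF degree_smult_le])
  qed (use S2_oval in auto)
  then obtain p where p: "degree p \<le> 2 * n - 1" "poly p 1 = 0" "\<And>h. h \<in> {0<..<1} \<Longrightarrow> M n h = poly p (\<psi> h) * \<psi> h powi N"
    by blast
  have "finite (isolated_zeros (M n) {0<..<1} \<inter> {0<..<1}) \<and>
    (\<Sum>h\<in>isolated_zeros (M n) {0<..<1} \<inter> {0<..<1}. zero_multiplicity (M n) h) \<le> enat (2 * n - 2)"
  \<comment> \<open>The derivative of \<open>sqrt (1 - h)\<close> is -1/2 times its inverse, which
    fixes \<kappa> and e.\<close>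
  proof (rule isolated_zeros_poly_comp[where \<psi> = \<psi> and e = "- 1" and N = N and p = p and \<kappa> = "- 1/2"])
    fix h :: real assume h: "h \<in> {0<..<1}"
    have "((\<lambda>h. sqrt (1 - h)) has_real_derivative (inverse (sqrt (1 - h)) / 2) * (- 1)) (at h)"
      by (rule DERIV_chain2[OF DERIV_real_sqrt]) (use h in \<open>auto intro!: derivative_eq_intros\<close>)
    thus "(\<psi> has_real_derivative - 1/2 * \<psi> h powi (- 1)) (at h)"
      by (simp add: \<psi>_def[abs_def] power_int_minus field_simps)
  next
    show "inj_on \<psi> {0<..<1}" by (auto simp: inj_on_def \<psi>_def)
    show "(\<Sum>a | poly p a = 0 \<and> a \<in> \<psi> ` {0<..<1}. order a p) \<le> 2 * n - 2 \<or> p = 0"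
    proof (cases "p = 0")
      case False
      let ?R = "{a. poly p a = 0 \<and> a \<in> \<psi> ` {0<..<1}}"
      have fin: "finite ?R" using poly_roots_finite[OF False] by simp
      have "1 \<notin> ?R" using \<psi>(2) by force
      hence "order 1 p + (\<Sum>a\<in>?R. order a p) = (\<Sum>a\<in>insert 1 ?R. order a p)"
        using fin by simp
      also have "\<dots> \<le> degree p"
        using p(2) by (intro sum_order_subset_le_degree False) auto
      finally have "order 1 p + (\<Sum>a\<in>?R. order a p) \<le> 2 * n - 1" using p(1) by simp
      moreover have "order 1 p > 0" using p(2) False by (simp add: order_gt_0_iff)
      ultimately have "(\<Sum>a\<in>?R. order a p) \<le> 2 * n - 2" by linarith
      thus ?thesis by simp
    qed simp
  qed (use \<psi> p(3) in auto)
  thus ?thesis by (intro num_isolated_zeros_le) simp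
qed

theorem theorem1p2:
  fixes n :: nat
    and ap am bp bm :: "nat \<Rightarrow> nat \<Rightarrow> real"
    and M :: "system \<Rightarrow> real \<Rightarrow> real"
  assumes a_eq: "\<And>i j. i + j \<le> n \<Longrightarrow> ap i j = am i j"
    and b_eq: "\<And>i j. i + j \<le> n \<Longrightarrow> bp i j = bm i j"
    and M_eq: "\<And>s h. M s h =
      abelian_integral s (poly2 n ap) (poly2 n bp) (poly2 n am) (poly2 n bm) h"
  shows "num_isolated_zeros (M S1) (Sig S1) \<le> enat (2 * n)
    \<and> (n \<ge> 1 \<longrightarrow> num_isolated_zeros (M S2) (Sig S2) \<le> enat (2 * n - 1))
    \<and> (n = 0 \<longrightarrow> num_isolated_zeros (M S2) (Sig S2) \<le> enat 1)
    \<and> (n \<ge> 4 \<longrightarrow> num_isolated_zeros (M R19) (Sig R19) \<le> enat (2 * n - 3))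
    \<and> (n \<in> {0, 1, 2, 3} \<longrightarrow> num_isolated_zeros (M R19) (Sig R19) \<le> enat 4)
    \<and> (n \<ge> 3 \<longrightarrow> num_isolated_zeros (M R20) (Sig R20) \<le> enat (2 * n))
    \<and> (n \<in> {0, 1, 2} \<longrightarrow> num_isolated_zeros (M R20) (Sig R20) \<le> enat 3)"
proof -
  have "poly2 n am = poly2 n ap" "poly2 n bm = poly2 n bp"
    using a_eq b_eq by (auto simp: poly2_def fun_eq_iff intro!: sum.cong)
  hence M: "M s = abelian_integral s (poly2 n ap) (poly2 n bp) (poly2 n ap) (poly2 n bp)" for s
    by (intro ext) (simp add: M_eq)
  have le: "num_isolated_zeros F S \<le> enat b" if "num_isolated_zeros F S \<le> enat a" "a \<le> b" for F S a b
    using that by (meson enat_ord_simps(1) order_trans)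
  \<comment> \<open>Each stated bound is at least the one proved; for n = 0 the natural number 2 n -
    2 is 0.\<close>
  show ?thesis unfolding M
    by (intro conjI impI; (rule le[OF S1_bound] le[OF S2_bound] le[OF R_bound(1)] le[OF R_bound(2)])) auto
qed

end
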